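(* The geodesics in $(\hat M,\hat F)$ are subsets of paths $[a,b,c,d,e]\in\mathbf S$ with directions $\langle 0,2,4,6\rangle$. That is, every geodesic of $(\hat M,\hat F)$ is, as a path, a subset of some polygonal path $[a,b,c,d,e]$ with $a,b,c,d,e\in\hat M$ such that $b-a,\ c-b,\ d-c,\ e-d$ are positive multiples of $v_0,v_2,v_4,v_6$ respectively.
   Context: Structure. $\hat M=\mathbb R^2$ with canonical coordinates $(x^1,x^2)$ (superscripts are indices). $F_0$ is the norm on $\mathbb R^2$ whose unit sphere is the regular hexagon with vertices $\pm(0,1)$, $\pm(\sqrt3/2,1/2)$, $\pm(-\sqrt3/2,1/2)$. For $i\in\{0,\dots,11\}$ put $v_i=(\sin(\pi i/6),\cos(\pi i/6))$ (the direction of the hour hand at $i$ o'clock). $[p_1,\dots,p_n]$ denotes the concatenation of the oriented closed Euclidean segments $[p_1,p_2],\dots,[p_{n-1},p_n]$; it has directions $\langle\alpha_1,\dots,\alpha_{n-1}\rangle$ if each $p_{i+1}-p_i$ is a positive multiple of $v_{\alpha_i}$. $\mathbf S$ is the set of simplified preferred paths: a preferred path is a finite concatenation of segments each parallel to $v_0$, $v_2$ or $v_4$, and it is simplified if no segment of it is redundant, i.e. it can be written as $[p_1,\dots,p_n]$ with directions $\langle\alpha_1,\dots,\alpha_{n-1}\rangle$, $\alpha_i\in\{0,2,4,6,8,10\}$ and $\alpha_i\ne\alpha_{i+1}$ for all $i$. $\ell_E$ is Euclidean length. Fix $\hat\theta\in(\pi/3,\pi/2]$. For $p\in\hat M$,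 $A(p)$ is the set of $q\ne p$ such that the Euclidean angle between $q-p$ and $(0,1)$ is at most $\hat\theta$. Let $a_0,b_0,c_0,d_0\in\mathbb R^2$ be such that $b_0-a_0,\ c_0-b_0,\ d_0-c_0,\ a_0-d_0$ are positive multiples of $v_8,v_6,v_2,v_{10}$ respectively and $d_0-b_0$ is a positive multiple of $(\sin\hat\theta,\cos\hat\theta)$ (such a trapezoid exists and is unique up to Euclidean homothety); put $L_{\hat\theta}=\ell_E([d_0,a_0,b_0,c_0])/\ell_E([c_0,d_0])>1$. Let $f:\hat M\to\mathbb R$ be a continuous positive function such that $f(q)<f(p)$ whenever $q\in A(p)$, and $f(x)\in(1,L_{\hat\theta})$ for all $x\in\hat M$. Put $\hat F(x,y)=f(x)F_0(y)$ for $x\in\hat M$, $y\in T_x\hat M=\mathbb R^2$. For a piecewise smooth $\gamma:[t_0,s_0]\to\hat M$, $\ell_{\hat F}(\gamma)=\int_{t_0}^{s_0}\hat F(\gamma(t),\gamma'(t))\,dt$; $d_{\hat F}(p,q)$ is the infimum of $\ell_{\hat F}$ over piecewise smooth paths from $p$ to $q$. A minimizing path from $p$ to $q$ is a piecewise smooth path from $p$ to $q$ whose length equals $d_{\hat F}(p,q)$. A path $\gamma:I\to\hat M$, with $I\subset\mathbb R$ an interval, is a geodesic if it is locally minimizing: every $t\in I$ has a neighborhood $J$ in $I$ such that $\gamma|_{[t_1,t_2]}$ is a minimizing path for all $t_1\le t_2$ in $J$. Paths differing by a monotonic reparameterization are identified, and injective paths are identified with their images.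
   Formalization: An unbounded geodesic (e.g. a full vertical line when f depends only on x^2) lies in no [a,b,c,d,e], so containment is stated for every part of a geodesic with bounded image (all of it if bounded); geodesics are represented by parameterizations that never pause. *)

theory Defs
  imports "HOL-Analysis.Analysis"
begin

text \<open>The plane is \<open>real \<times> real\<close>; its \<open>norm\<close>, \<open>dist\<close> and \<open>inner\<close> are the Euclidean ones.\<close>

type_synonym plane = "real \<times> real"

definition clock :: "nat \<Rightarrow> plane" where
  "clock i = (sin (pi * real i / 6), cos (pi * real i / 6))"

definition hexagon :: "plane set" where
  "hexagon = convex hull
     {(0, 1), - (0, 1),
      (sqrt 3 / 2, 1 / 2), - (sqrt 3 / 2, 1 / 2),
      (- sqrt 3 / 2, 1 / 2), - (- sqrt 3 / 2, 1 / 2)}"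

text \<open>The norm with unit ball \<open>hexagon\<close>, as its Minkowski functional.\<close>

definition F0 :: "plane \<Rightarrow> real" where
  "F0 y = Inf {r. 0 < r \<and> y /\<^sub>R r \<in> hexagon}"

subsection \<open>Polygonal paths\<close>

fun polygonal_path :: "plane list \<Rightarrow> real \<Rightarrow> plane" where
  "polygonal_path [p] = linepath p p"
| "polygonal_path [p, q] = linepath p q"
| "polygonal_path (p # q # r # ps) = linepath p q +++ polygonal_path (q # r # ps)"

definition euclidean_length :: "plane list \<Rightarrow> real" where
  "euclidean_length ps = (\<Sum>i<length ps - 1. dist (ps ! i) (ps ! Suc i))"

definition positive_multiple :: "plane \<Rightarrow> plane \<Rightarrow> bool" where
  "positive_multiple w u \<longleftrightarrow> (\<exists>r>0. w = r *\<^sub>R u)"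

definition has_directions :: "plane list \<Rightarrow> nat list \<Rightarrow> bool" where
  "has_directions ps as \<longleftrightarrow>
     length ps = Suc (length as) \<and>
     (\<forall>i<length as. positive_multiple (ps ! Suc i - ps ! i) (clock (as ! i)))"

definition simplified_preferred_paths :: "plane list set" where
  "simplified_preferred_paths =
     {ps. \<exists>as. has_directions ps as \<and> set as \<subseteq> {0, 2, 4, 6, 8, 10} \<and>
               (\<forall>i. Suc i < length as \<longrightarrow> as ! i \<noteq> as ! Suc i)}"

subsection \<open>The cones and the trapezoid\<close>

definition euclidean_angle :: "plane \<Rightarrow> plane \<Rightarrow> real" where
  "euclidean_angle u w = arccos (inner u w / (norm u * norm w))"

definition cone_at :: "real \<Rightarrow> plane \<Rightarrow> plane set" where
  "cone_at \<theta> p = {q. q \<noteq> p \<and> euclidean_angle (q - p) (0, 1) \<le> \<theta>}"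

definition trapezoid :: "real \<Rightarrow> plane \<Rightarrow> plane \<Rightarrow> plane \<Rightarrow> plane \<Rightarrow> bool" where
  "trapezoid \<theta> a b c d \<longleftrightarrow>
     positive_multiple (b - a) (clock 8) \<and>
     positive_multiple (c - b) (clock 6) \<and>
     positive_multiple (d - c) (clock 2) \<and>
     positive_multiple (a - d) (clock 10) \<and>
     positive_multiple (d - b) (sin \<theta>, cos \<theta>)"

subsection \<open>Length, distance and geodesics of a Finsler structure\<close>

text \<open>\<open>C\<^sup>\<infinity>\<close> on the closed interval \<open>{s..t}\<close>, with one-sided derivatives at the ends;
  \<open>D n\<close> is the \<open>n\<close>-th derivative.\<close>

definition smooth_on_interval :: "(real \<Rightarrow> plane) \<Rightarrow> real \<Rightarrow> real \<Rightarrow> bool" where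
  "smooth_on_interval \<gamma> s t \<longleftrightarrow>
     (\<exists>D :: nat \<Rightarrow> real \<Rightarrow> plane.
        (\<forall>x\<in>{s..t}. D 0 x = \<gamma> x) \<and>
        (\<forall>n. \<forall>x\<in>{s..t}. (D n has_vector_derivative D (Suc n) x) (at x within {s..t})))"

text \<open>The library's \<open>piecewise_C1_differentiable_on\<close> would not do here: it puts no condition on
  the derivative near the break points, so the speed could fail to be integrable and the
  integral in \<open>finsler_length\<close> would take the default value 0. Each piece below is smooth on a
  closed interval, which also makes the whole path continuous.\<close>

definition piecewise_smooth :: "(real \<Rightarrow> plane) \<Rightarrow> real \<Rightarrow> real \<Rightarrow> bool" where
  "piecewise_smooth \<gamma> s t \<longleftrightarrow>
     (\<exists>(n::nat) (u :: nat \<Rightarrow> real). u 0 = s \<and> u n = t \<and>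
        (\<forall>i<n. u i < u (Suc i) \<and> smooth_on_interval \<gamma> (u i) (u (Suc i))))"

definition finsler_length ::
    "(plane \<Rightarrow> plane \<Rightarrow> real) \<Rightarrow> (real \<Rightarrow> plane) \<Rightarrow> real \<Rightarrow> real \<Rightarrow> real" where
  "finsler_length F \<gamma> s t =
     integral {s..t} (\<lambda>x. F (\<gamma> x) (vector_derivative \<gamma> (at x within {s..t})))"

definition finsler_dist :: "(plane \<Rightarrow> plane \<Rightarrow> real) \<Rightarrow> plane \<Rightarrow> plane \<Rightarrow> real" where
  "finsler_dist F p q =
     Inf {finsler_length F \<gamma> s t | \<gamma> s t. piecewise_smooth \<gamma> s t \<and> \<gamma> s = p \<and> \<gamma> t = q}"

definition minimizing_path ::
    "(plane \<Rightarrow> plane \<Rightarrow> real) \<Rightarrow> (real \<Rightarrow> plane) \<Rightarrow> real \<Rightarrow> real \<Rightarrow> bool" where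
  "minimizing_path F \<gamma> s t \<longleftrightarrow>
     piecewise_smooth \<gamma> s t \<and> finsler_length F \<gamma> s t = finsler_dist F (\<gamma> s) (\<gamma> t)"

definition locally_minimizing ::
    "(plane \<Rightarrow> plane \<Rightarrow> real) \<Rightarrow> (real \<Rightarrow> plane) \<Rightarrow> real set \<Rightarrow> bool" where
  "locally_minimizing F \<gamma> I \<longleftrightarrow>
     (\<forall>t\<in>I. \<exists>J. openin (top_of_set I) J \<and> t \<in> J \<and>
        (\<forall>t1\<in>J. \<forall>t2\<in>J. t1 \<le> t2 \<longrightarrow> minimizing_path F \<gamma> t1 t2))"

text \<open>Paths are considered up to monotonic reparameterization, so a path is represented by a
  parameterization that does not pause (a constant path by one whose interval is a point).
  This is not only a normalization: if pauses were allowed, every polygonal path whose single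
  edges are minimizing would be locally minimizing once it pauses at each of its vertices,
  because no small parameter interval would then see a corner.\<close>

definition pauses_nowhere :: "(real \<Rightarrow> plane) \<Rightarrow> real set \<Rightarrow> bool" where
  "pauses_nowhere \<gamma> I \<longleftrightarrow>
     (\<forall>s\<in>I. \<forall>t\<in>I. s < t \<longrightarrow> (\<exists>x\<in>{s..t}. \<gamma> x \<noteq> \<gamma> s))"

definition finsler_geodesic ::
    "(plane \<Rightarrow> plane \<Rightarrow> real) \<Rightarrow> (real \<Rightarrow> plane) \<Rightarrow> real set \<Rightarrow> bool" where
  "finsler_geodesic F \<gamma> I \<longleftrightarrow>
     is_interval I \<and> pauses_nowhere \<gamma> I \<and> locally_minimizing F \<gamma> I"

text \<open>An injective path is identified with its image, so that \<open>\<gamma>\<close> on \<open>I\<close> is, as a path, a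
  subset of the (injective) path \<open>P\<close> if it is injective with image contained in that of \<open>P\<close>.
  A geodesic on an arbitrary interval can be unbounded (if \<open>f\<close> depends on the second coordinate
  only, entire vertical lines are geodesics), and then no path with vertices in the plane contains
  it. The theorem therefore covers all restrictions with bounded image, and the geodesic
  itself whenever it is bounded.\<close>

definition subpath_of :: "(real \<Rightarrow> plane) \<Rightarrow> real set \<Rightarrow> (real \<Rightarrow> plane) \<Rightarrow> bool" where
  "subpath_of \<gamma> I P \<longleftrightarrow> inj_on \<gamma> I \<and> \<gamma> ` I \<subseteq> path_image P"

end

theory Submission
  imports Defs "HOL-Library.Sublist"
begin

text \<open>Geodesics minimize only locally, and near a point \<open>f\<close> is almost constant by continuity; there, a
  minimizing path is determined by comparisons.

  A segment in the direction \<open>u\<close> of a vertex of the hexagon is the only minimizer between its ends.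
  Since \<open>\<theta> > pi / 3\<close>, the vertices pointing upwards are interior to the cone in which \<open>f\<close>
  decreases, so \<open>f\<close> at distance \<open>Y\<close> from the line is larger than \<open>f\<close> on the line at the parameter
  \<open>X + Y / \<eta>\<close>. A function of \<open>X + Y / \<eta>\<close> then calibrates the segment: its gradient is dominated by
  \<open>f F0\<close>, because leaving the line costs at least \<open>Y / sqrt 3\<close> while the gain
  is \<open>Y / \<eta>\<close> times the small oscillation of \<open>f\<close>.

  Consequently a minimizing path whose ends differ by a vector of one of the six sectors is monotone
  in that sector: otherwise two of its points would differ by a boundary direction and the path would be
  straight between them. On such paths \<open>F0\<close> is linear, and comparing points of equal level shows that
  the path must first follow the side of the sector that keeps it higher, then the other side.

  So a geodesic is locally a polygonal path with turns \<open>0 \<rightarrow> 2 \<rightarrow> 4 \<rightarrow> 6\<close> or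
  \<open>0 \<rightarrow> 10 \<rightarrow> 8 \<rightarrow> 6\<close>, hence has at most four edges. The second kind is the first one traversed backwards.\<close>

section \<open>The hexagonal norm\<close>

lemma clock_values:
  "clock 0 = (0, 1)" "clock 2 = (sqrt 3 / 2, 1 / 2)" "clock 4 = (sqrt 3 / 2, - 1 / 2)"
  "clock 6 = (0, - 1)" "clock 8 = (- sqrt 3 / 2, - 1 / 2)" "clock 10 = (- sqrt 3 / 2, 1 / 2)"
proof -
  have opp: "clock (i + 6) = - clock i" for i
  proof -
    have "pi * real (i + 6) / 6 = pi * real i / 6 + pi" by (simp add: field_simps)
    then show ?thesis unfolding clock_def by (simp only: sin_periodic_pi cos_periodic_pi uminus_Pair)
  qed
  have a: "pi * 2 / 6 = pi / 3" "pi * 4 / 6 = pi - pi / 3" by auto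
  show 0: "clock 0 = (0, 1)" by (simp add: clock_def)
  show 2: "clock 2 = (sqrt 3 / 2, 1 / 2)" by (simp add: clock_def a sin_60 cos_60)
  have "sin (pi - pi / 3) = sqrt 3 / 2" "cos (pi - pi / 3) = - 1 / 2"
    unfolding sin_diff cos_diff by (simp_all add: sin_60 cos_60)
  then show 4: "clock 4 = (sqrt 3 / 2, - 1 / 2)" by (simp add: clock_def a)
  show "clock 6 = (0, - 1)" "clock 8 = (- sqrt 3 / 2, - 1 / 2)" "clock 10 = (- sqrt 3 / 2, 1 / 2)"
    using opp[of 0] opp[of 2] opp[of 4] 0 2 4 by simp_all
qed

text \<open>A pair \<open>(d, e)\<close> spans a sector of the hexagon; \<open>d\<close> comes first because \<open>clock d - clock e\<close>
  is one of the upward directions \<open>updirs\<close>.\<close>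

definition turn :: "(nat \<times> nat) set" where
  "turn = {(0, 2), (2, 4), (4, 6), (0, 10), (10, 8), (8, 6)}"

text \<open>The closed form of \<open>F0\<close>, as \<open>F0_eq\<close> confirms. The first entry
  of the maximum comes from the two vertical sides of the hexagon, the second from the four slanted
  ones.\<close>

definition hexnorm :: "plane \<Rightarrow> real" where
  "hexnorm v = max (2 * \<bar>fst v\<bar> / sqrt 3) (\<bar>snd v\<bar> + \<bar>fst v\<bar> / sqrt 3)"

text \<open>Measuring the first coordinate in units of \<open>sqrt 3\<close> makes all coefficients
  rational, so that the sector computations become linear arithmetic.\<close>

lemma hexnorm_sqrt3: "hexnorm (sqrt 3 * s, y) = max (2 * \<bar>s\<bar>) (\<bar>y\<bar> + \<bar>s\<bar>)"
  by (simp add: hexnorm_def abs_mult)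

text \<open>A sector is the cone over one side of the hexagon, and on such a cone the norm is
  linear. So the \<open>F0\<close>-speed of a path whose velocity stays in one sector is the
  derivative of its coordinate sum.\<close>

lemma hexnorm_sector:
  assumes "(d, e) \<in> turn" "0 \<le> a" "0 \<le> b"
  shows "hexnorm (a *\<^sub>R clock d + b *\<^sub>R clock e) = a + b"
proof -
  have 1: "a *\<^sub>R clock 0 + b *\<^sub>R clock 2 = (sqrt 3 * (b / 2), a + b / 2)"
    and 2: "a *\<^sub>R clock 2 + b *\<^sub>R clock 4 = (sqrt 3 * ((a + b) / 2), a / 2 - b / 2)"
    and 3: "a *\<^sub>R clock 4 + b *\<^sub>R clock 6 = (sqrt 3 * (a / 2), - a / 2 - b)"
    and 4: "a *\<^sub>R clock 0 + b *\<^sub>R clock 10 = (sqrt 3 * (- b / 2), a + b / 2)"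
    and 5: "a *\<^sub>R clock 10 + b *\<^sub>R clock 8 = (sqrt 3 * (- (a + b) / 2), a / 2 - b / 2)"
    and 6: "a *\<^sub>R clock 8 + b *\<^sub>R clock 6 = (sqrt 3 * (- a / 2), - a / 2 - b)"
    by (simp_all add: clock_values field_simps)
  show ?thesis
    using assms(1) unfolding turn_def
    apply (clarsimp, elim disjE conjE)
    apply (simp_all only: 1 2 3 4 5 6 hexnorm_sqrt3)
    using assms(2,3) by (auto simp: abs_if max_def field_simps)
qed

lemma sector_cover:
  obtains d e a b where "(d, e) \<in> turn" "0 \<le> a" "0 \<le> b" "v = a *\<^sub>R clock d + b *\<^sub>R clock e"
proof -
  obtain x y where v: "v = (x, y)" by fastforce
  \<comment> \<open>In the coordinates (s, y) the rays through the vertices lie on the lines s = 0,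
    y = s and y = -s.\<close>
  define s where "s = x / sqrt 3"
  have x: "x = s * sqrt 3" by (simp add: s_def)
  consider "0 \<le> s" "s \<le> y" | "0 \<le> s" "- s \<le> y" "y \<le> s" | "0 \<le> s" "y \<le> - s"
    | "s \<le> 0" "- s \<le> y" | "s \<le> 0" "s \<le> y" "y \<le> - s" | "s \<le> 0" "y \<le> s"
    by linarith
  then show thesis
  proof cases
    case 1 show ?thesis
      by (rule that[of 0 2 "y - s" "2 * s"]) (use 1 in \<open>auto simp: turn_def clock_values v x\<close>)
  next
    case 2 show ?thesis
      by (rule that[of 2 4 "s + y" "s - y"]) (use 2 in \<open>auto simp: turn_def clock_values v x field_simps\<close>)
  next
    case 3 show ?thesis
      by (rule that[of 4 6 "2 * s" "- s - y"]) (use 3 in \<open>auto simp: turn_def clock_values v x\<close>)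
  next
    case 4 show ?thesis
      by (rule that[of 0 10 "y + s" "- 2 * s"]) (use 4 in \<open>auto simp: turn_def clock_values v x\<close>)
  next
    case 5 show ?thesis
      by (rule that[of 10 8 "y - s" "- s - y"]) (use 5 in \<open>auto simp: turn_def clock_values v x field_simps\<close>)
  next
    case 6 show ?thesis
      by (rule that[of 8 6 "- 2 * s" "s - y"]) (use 6 in \<open>auto simp: turn_def clock_values v x\<close>)
  qed
qed

lemma hexnorm_scale: "0 \<le> r \<Longrightarrow> hexnorm (r *\<^sub>R v) = r * hexnorm v"
  by (simp add: hexnorm_def abs_mult max_mult_distrib_left algebra_simps)

lemma hexnorm_nonneg: "0 \<le> hexnorm v"
  by (simp add: hexnorm_def le_max_iff_disj)

lemma hexnorm_triangle: "hexnorm (v + w) \<le> hexnorm v + hexnorm w"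
proof -
  have max_add: "max (2 * c) (r + c) \<le> max (2 * a) (p + a) + max (2 * b) (q + b)"
    if "c \<le> a + b" "r \<le> p + q" for a b c p q r :: real
    using that by (simp add: max_def)
  have "\<bar>fst v + fst w\<bar> / sqrt 3 \<le> \<bar>fst v\<bar> / sqrt 3 + \<bar>fst w\<bar> / sqrt 3"
    unfolding add_divide_distrib[symmetric] by (rule divide_right_mono) auto
  from max_add[OF this, of "\<bar>snd v + snd w\<bar>" "\<bar>snd v\<bar>" "\<bar>snd w\<bar>"] show ?thesis
    by (simp add: hexnorm_def)
qed

text \<open>One inclusion is minimality of the convex hull, the ball of \<open>hexnorm\<close> being
  convex. For the other, a vector in a sector is a point on a side, pulled towards the centre by the
  factor a + b.\<close>

lemma hexagon_eq: "hexagon = {v. hexnorm v \<le> 1}"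
proof
  have "convex {v. hexnorm v \<le> 1}"
  proof (rule convexI)
    fix x y u v assume H: "x \<in> {v. hexnorm v \<le> 1}" "y \<in> {v. hexnorm v \<le> 1}" "0 \<le> u" "0 \<le> v" "u + v = (1::real)"
    have "hexnorm (u *\<^sub>R x + v *\<^sub>R y) \<le> u * hexnorm x + v * hexnorm y"
      using hexnorm_triangle[of "u *\<^sub>R x" "v *\<^sub>R y"] H by (simp add: hexnorm_scale)
    also have "\<dots> \<le> 1" using H by (simp add: convex_bound_le)
    finally show "u *\<^sub>R x + v *\<^sub>R y \<in> {v. hexnorm v \<le> 1}" by simp
  qed
  then show "hexagon \<subseteq> {v. hexnorm v \<le> 1}"
    unfolding hexagon_def by (intro hull_minimal) (auto simp: hexnorm_def)
next
  have clock_hex: "clock i \<in> hexagon" if "i \<in> {0, 2, 4, 6, 8, 10}" for i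
    unfolding hexagon_def by (rule hull_inc) (use that in \<open>auto simp: clock_values\<close>)
  have conv: "convex hexagon" by (simp add: hexagon_def)
  have "(1/2) *\<^sub>R clock 0 + (1/2) *\<^sub>R clock 6 \<in> hexagon"
    by (intro convexD conv clock_hex) auto
  then have zero: "0 \<in> hexagon" by (simp add: clock_values zero_prod_def)
  show "{v. hexnorm v \<le> 1} \<subseteq> hexagon"
  proof safe
    fix x y :: real assume le: "hexnorm (x, y) \<le> 1"
    obtain d e a b where v: "(d, e) \<in> turn" "0 \<le> a" "0 \<le> b" "(x, y) = a *\<^sub>R clock d + b *\<^sub>R clock e"
      by (rule sector_cover)
    have ab: "a + b \<le> 1" using le hexnorm_sector[OF v(1-3)] v(4) by simp
    have de: "clock d \<in> hexagon" "clock e \<in> hexagon"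
      using v(1) by (auto simp: turn_def intro!: clock_hex)
    show "(x, y) \<in> hexagon"
    proof (cases "a + b = 0")
      case True then have "a = 0" "b = 0" using v by auto
      then show ?thesis using v zero by simp
    next
      case False
      then have pos: "a + b > 0" using v by auto
      have q: "(a / (a + b)) *\<^sub>R clock d + (b / (a + b)) *\<^sub>R clock e \<in> hexagon" (is "?q \<in> _")
        by (intro convexD conv de) (use v pos in \<open>auto simp: add_divide_distrib[symmetric]\<close>)
      have "(a + b) *\<^sub>R ?q + (1 - (a + b)) *\<^sub>R 0 \<in> hexagon"
        by (intro convexD conv q zero) (use pos ab in auto)
      then show ?thesis using v(4) pos by (simp add: scaleR_add_right)
    qed
  qed
qed

lemma F0_eq: "F0 v = hexnorm v"
proof -
  have nn: "hexnorm v \<ge> 0" by (rule hexnorm_nonneg)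
  have "{r. 0 < r \<and> v /\<^sub>R r \<in> hexagon} = {r. 0 < r \<and> hexnorm v \<le> r}"
    by (auto simp: hexagon_eq hexnorm_scale field_simps)
  also have "Inf \<dots> = hexnorm v"
  proof (cases "hexnorm v = 0")
    \<comment> \<open>For the zero vector the admissible radii form an open half-line, and the
      infimum 0 is not attained.\<close>
    case True
    then have "{r. 0 < r \<and> hexnorm v \<le> r} = {0<..}" by auto
    then show ?thesis using True by simp
  next
    case False
    then have "{r. 0 < r \<and> hexnorm v \<le> r} = {hexnorm v..}" using nn by auto
    then show ?thesis by simp
  qed
  finally show ?thesis by (simp add: F0_def)
qed

lemma F0_sector:
  assumes "(d, e) \<in> turn" "0 \<le> a" "0 \<le> b"
  shows "F0 (a *\<^sub>R clock d + b *\<^sub>R clock e) = a + b"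
  using hexnorm_sector[OF assms] by (simp add: F0_eq)

lemma continuous_F0: "continuous_on UNIV F0"
  unfolding F0_eq[abs_def] hexnorm_def by (intro continuous_intros) auto

lemma F0_nonneg: "0 \<le> F0 v"
  by (simp add: F0_eq hexnorm_nonneg)

section \<open>Coordinates along a vertex direction and the cone of decrease\<close>

definition perp :: "plane \<Rightarrow> plane" where
  "perp u = (snd u, - fst u)"

text \<open>The vertices of the hexagon in the upper half plane. The other three are their
  negatives.\<close>

definition updirs :: "nat set" where
  "updirs = {0, 2, 10}"

text \<open>With X, Y the coordinates along and across \<open>clock d\<close>, the four sides of the
  hexagon at \<open>clock d\<close> and its negative lie on the sides of the rhombus |X| + |Y| /
  sqrt 3 = 1, so the rhombus contains the hexagon. The second summand is the price of leaving the
  line.\<close>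

lemma F0_lower:
  assumes "d \<in> updirs"
  shows "\<bar>inner (clock d) v\<bar> + \<bar>inner (perp (clock d)) v\<bar> / sqrt 3 \<le> F0 v"
proof -
  define s y where "s = fst v / sqrt 3" and "y = snd v"
  then have v: "v = (sqrt 3 * s, y)" by (simp add: prod_eq_iff)
  have F: "F0 v = max (2 * \<bar>s\<bar>) (\<bar>y\<bar> + \<bar>s\<bar>)"
    by (simp add: F0_eq v hexnorm_sqrt3)
  have 0: "inner (clock 0) v = y" "inner (perp (clock 0)) v = sqrt 3 * s"
    and 2: "inner (clock 2) v = 3 / 2 * s + y / 2" "inner (perp (clock 2)) v = sqrt 3 * (s / 2 - y / 2)"
    and 10: "inner (clock 10) v = - 3 / 2 * s + y / 2" "inner (perp (clock 10)) v = sqrt 3 * (s / 2 + y / 2)"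
    by (simp_all add: clock_values v perp_def algebra_simps)
  have e: "\<bar>sqrt 3 * w\<bar> / sqrt 3 = \<bar>w\<bar>" for w by (simp add: abs_mult)
  from assms show ?thesis
    unfolding updirs_def by (elim insertE emptyE; simp only: F 0 2 10 e; arith)
qed

text \<open>Each upward vertex makes an angle of at most pi / 3 with (0, 1). As this is less than
  \<theta>, a thin cone around it still lies in \<open>cone_at\<close>.\<close>

lemma cone_contains:
  assumes "pi / 3 < \<theta>" "\<theta> \<le> pi / 2"
  obtains \<eta> where "0 < \<eta>"
    "\<And>d z r \<beta>. \<lbrakk>d \<in> updirs; 0 < r; \<bar>\<beta>\<bar> \<le> \<eta> * r\<rbrakk> \<Longrightarrow> z + r *\<^sub>R clock d + \<beta> *\<^sub>R perp (clock d) \<in> cone_at \<theta> z"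
proof -
  define c where "c = cos \<theta>"
  have c: "c < 1 / 2"
    using assms cos_monotone_0_pi[of "pi/3" \<theta>] pi_gt_zero by (simp add: c_def cos_60)
  have c0: "0 \<le> c" unfolding c_def using assms pi_gt_zero by (intro cos_ge_zero) auto
  \<comment> \<open>Solves 1 / 2 - \<eta> = c (1 + \<eta>): the left side bounds the height of the
    vector from below, and 1 + \<eta> bounds its norm from above, both relative to r.\<close>
  define \<eta> where "\<eta> = (1 / 2 - c) / (1 + c)"
  have eta: "0 < \<eta>" "1 / 2 - \<eta> = c * (1 + \<eta>)" "\<eta> \<le> 1 / 2"
    using c c0 by (auto simp: \<eta>_def field_simps)
  show thesis
  proof
    show "0 < \<eta>" by fact
    fix d z r \<beta> assume d: "d \<in> updirs" and r: "0 < r" and b: "\<bar>\<beta>\<bar> \<le> \<eta> * r"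
    define w where "w = r *\<^sub>R clock d + \<beta> *\<^sub>R perp (clock d)"
    have nc: "norm (clock d) = 1" "norm (perp (clock d)) = 1"
      using d by (auto simp: updirs_def clock_values perp_def norm_prod_def power_divide)
    have "norm w \<le> r + \<bar>\<beta>\<bar>"
      unfolding w_def using norm_triangle_ineq[of "r *\<^sub>R clock d" "\<beta> *\<^sub>R perp (clock d)"] nc r by simp
    also have "\<dots> \<le> (1 + \<eta>) * r" using b by (simp add: algebra_simps)
    finally have nw: "norm w \<le> (1 + \<eta>) * r" .
    have "\<bar>snd (perp (clock d))\<bar> \<le> 1" using norm_snd_le[of "snd (perp (clock d))" "fst (perp (clock d))"] nc by simp
    then have "\<bar>\<beta> * snd (perp (clock d))\<bar> \<le> \<bar>\<beta>\<bar>"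
      unfolding abs_mult by (simp add: mult_left_le)
    moreover have "r / 2 \<le> r * snd (clock d)" using d r by (auto simp: updirs_def clock_values)
    ultimately have sw: "(1 / 2 - \<eta>) * r \<le> snd w" using b by (simp add: w_def algebra_simps)
    have w0: "w \<noteq> 0"
    proof
      assume "w = 0"
      then have "r *\<^sub>R clock d = - (\<beta> *\<^sub>R perp (clock d))" unfolding w_def by (simp add: eq_neg_iff_add_eq_0)
      then have "norm (r *\<^sub>R clock d) = norm (\<beta> *\<^sub>R perp (clock d))" by (metis norm_minus_cancel)
      then have "r = \<bar>\<beta>\<bar>" using nc r by simp
      also have "\<dots> \<le> r / 2" using b r mult_right_mono[OF eta(3), of r] by linarith
      finally show False using r by simp
    qed
    have "c * norm w \<le> c * ((1 + \<eta>) * r)" using nw c0 by (rule mult_left_mono)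
    also have "\<dots> \<le> snd w" using sw eta(2) by (simp add: mult.assoc)
    finally have "c \<le> snd w / norm w" using w0 by (simp add: field_simps)
    moreover have "snd w / norm w \<le> 1"
    proof -
      have "snd w \<le> norm w" using norm_snd_le[of "snd w" "fst w"] by simp
      then show ?thesis using w0 by simp
    qed
    ultimately have "arccos (snd w / norm w) \<le> arccos c"
      using c0 by (intro arccos_le_arccos) auto
    also have "arccos c = \<theta>" unfolding c_def using assms pi_gt_zero by (intro arccos_cos) auto
    finally have "z + w \<in> cone_at \<theta> z"
      using w0 by (simp add: cone_at_def euclidean_angle_def inner_prod_def norm_prod_def)
    then show "z + r *\<^sub>R clock d + \<beta> *\<^sub>R perp (clock d) \<in> cone_at \<theta> z"
      by (simp add: w_def add.assoc)
  qed
qed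

section \<open>Lengths of piecewise smooth paths\<close>

lemma piecewise_smooth_refl: "piecewise_smooth \<gamma> s s"
  unfolding piecewise_smooth_def by (intro exI[of _ "0::nat"] exI[of _ "\<lambda>_. s"]) auto

lemma piecewise_smooth_append:
  assumes "piecewise_smooth \<gamma> s t" "t < r" "smooth_on_interval \<gamma> t r"
  shows "piecewise_smooth \<gamma> s r"
proof -
  obtain n u where u: "u 0 = s" "u n = t" "\<forall>i<n. u i < u (Suc i) \<and> smooth_on_interval \<gamma> (u i) (u (Suc i))"
    using assms(1) unfolding piecewise_smooth_def by blast
  show ?thesis unfolding piecewise_smooth_def
    by (rule exI[of _ "Suc n"], rule exI[of _ "u(Suc n := r)"])
      (use u assms(2,3) in \<open>auto simp: less_Suc_eq\<close>)
qed

text \<open>Induction over the smooth pieces from left to right: a property of initial intervals is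
  carried across one piece at a time.\<close>

lemma piecewise_smooth_induct [consumes 1, case_names refl append]:
  assumes "piecewise_smooth \<gamma> s t"
    and "P s"
    and "\<And>t r. \<lbrakk>s \<le> t; P t; t < r; smooth_on_interval \<gamma> t r\<rbrakk> \<Longrightarrow> P r"
  shows "s \<le> t \<and> P t"
proof -
  obtain n u where u: "u 0 = s" "u n = t" "\<forall>i<n. u i < u (Suc i) \<and> smooth_on_interval \<gamma> (u i) (u (Suc i))"
    using assms(1) unfolding piecewise_smooth_def by blast
  have "k \<le> n \<Longrightarrow> s \<le> u k \<and> P (u k)" for k
  proof (induction k)
    case 0 then show ?case using u assms(2) by simp
  next
    case (Suc k)
    then show ?case using u(3)[rule_format, of k] assms(3)[of "u k" "u (Suc k)"] by auto
  qed
  from this[of n] show ?thesis using u by simp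
qed

lemma piecewise_smooth_le: "piecewise_smooth \<gamma> s t \<Longrightarrow> s \<le> t"
  using piecewise_smooth_induct[of \<gamma> s t "\<lambda>_. True"] by blast

lemma smooth_on_interval_C1:
  assumes "smooth_on_interval \<gamma> s t"
  obtains D where "\<And>x. x \<in> {s..t} \<Longrightarrow> (\<gamma> has_vector_derivative D x) (at x within {s..t})"
    "continuous_on {s..t} D"
proof -
  obtain D where D: "\<forall>x\<in>{s..t}. D 0 x = \<gamma> x"
    "\<forall>n. \<forall>x\<in>{s..t}. (D n has_vector_derivative D (Suc n) x) (at x within {s..t})"
    using assms unfolding smooth_on_interval_def by blast
  show thesis
  proof (rule that[of "D 1"])
    fix x assume x: "x \<in> {s..t}"
    have "(D 0 has_vector_derivative D 1 x) (at x within {s..t})" using D(2) x by (metis One_nat_def)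
    then show "(\<gamma> has_vector_derivative D 1 x) (at x within {s..t})"
      by (rule has_vector_derivative_transform[rotated 2]) (use D x in auto)
  next
    show "continuous_on {s..t} (D 1)"
      unfolding continuous_on_eq_continuous_within
      using D(2) has_vector_derivative_continuous by blast
  qed
qed

lemma piecewise_smooth_continuous:
  assumes "piecewise_smooth \<gamma> s t"
  shows "continuous_on {s..t} \<gamma>"
proof -
  have "s \<le> t \<and> continuous_on {s..t} \<gamma>"
    using assms
  proof (induction rule: piecewise_smooth_induct)
    case (append t r)
    obtain D where "\<And>x. x \<in> {t..r} \<Longrightarrow> (\<gamma> has_vector_derivative D x) (at x within {t..r})"
      using smooth_on_interval_C1[OF append(4)] by metis
    then have "continuous_on {t..r} \<gamma>"
      unfolding continuous_on_eq_continuous_within using has_vector_derivative_continuous by blast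
    then have "continuous_on ({s..t} \<union> {t..r}) \<gamma>"
      using append by (intro continuous_on_closed_Un) auto
    then show ?case using append by (simp add: ivl_disj_un_two_touch)
  qed auto
  then show ?thesis ..
qed

lemma piecewise_smooth_derivative:
  assumes "piecewise_smooth \<gamma> s t"
  obtains S where "finite S"
    "\<And>x. x \<in> {s<..<t} - S \<Longrightarrow> (\<gamma> has_vector_derivative vector_derivative \<gamma> (at x)) (at x)"
proof -
  have "s \<le> t \<and> (\<exists>S. finite S \<and> (\<forall>x\<in>{s<..<t} - S. (\<gamma> has_vector_derivative vector_derivative \<gamma> (at x)) (at x)))"
    using assms
  proof (induction rule: piecewise_smooth_induct)
    case (append t r)
    then obtain S where S: "finite S" "\<forall>x\<in>{s<..<t} - S. (\<gamma> has_vector_derivative vector_derivative \<gamma> (at x)) (at x)"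
      by blast
    obtain D where D: "\<And>x. x \<in> {t..r} \<Longrightarrow> (\<gamma> has_vector_derivative D x) (at x within {t..r})"
      using smooth_on_interval_C1[OF append(4)] by metis
    have "(\<gamma> has_vector_derivative vector_derivative \<gamma> (at x)) (at x)" if "x \<in> {t<..<r}" for x
      using D[of x] that by (auto simp: at_within_Icc_at vector_derivative_at)
    then have "\<forall>x\<in>{s<..<r} - insert t S. (\<gamma> has_vector_derivative vector_derivative \<gamma> (at x)) (at x)"
      using S(2) by (metis DiffE DiffI greaterThanLessThan_iff insertCI linorder_neqE_linordered_idom)
    then show ?case using S(1) by blast
  qed auto
  then show thesis using that by blast
qed

text \<open>The integrand of \<open>finsler_length\<close>, but with the two-sided derivative. The
  two can differ only at the ends of the interval, and this version does not depend on the
  interval.\<close>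

definition speed :: "(plane \<Rightarrow> real) \<Rightarrow> (real \<Rightarrow> plane) \<Rightarrow> real \<Rightarrow> real" where
  "speed f \<gamma> x = f (\<gamma> x) * F0 (vector_derivative \<gamma> (at x))"

lemma finsler_length_speed:
  "finsler_length (\<lambda>x y. f x * F0 y) \<gamma> s t = integral {s..t} (speed f \<gamma>)"
  unfolding finsler_length_def
  by (rule integral_spike[of "{s, t}"]) (auto simp: speed_def at_within_Icc_at)

lemma speed_integrable:
  assumes "piecewise_smooth \<gamma> s t" "continuous_on UNIV f"
  shows "speed f \<gamma> integrable_on {s..t}"
proof -
  have "s \<le> t \<and> speed f \<gamma> integrable_on {s..t}"
    using assms(1)
  proof (induction rule: piecewise_smooth_induct)
    case refl
    show ?case using integrable_on_refl[of "speed f \<gamma>" s] by simp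
  next
    case (append t r)
    obtain D where D: "\<And>x. x \<in> {t..r} \<Longrightarrow> (\<gamma> has_vector_derivative D x) (at x within {t..r})"
        "continuous_on {t..r} D"
      using smooth_on_interval_C1[OF append(4)] by metis
    have cg: "continuous_on {t..r} \<gamma>"
      unfolding continuous_on_eq_continuous_within using D has_vector_derivative_continuous by blast
    have "(\<lambda>x. f (\<gamma> x) * F0 (D x)) integrable_on {t..r}"
      by (intro integrable_continuous_interval continuous_on_mult
          continuous_on_compose2[OF assms(2) cg] continuous_on_compose2[OF continuous_F0 D(2)]) auto
    moreover have "speed f \<gamma> x = f (\<gamma> x) * F0 (D x)" if "x \<in> {t..r} - {t, r}" for x
      using D(1)[of x] that by (auto simp: speed_def at_within_Icc_at vector_derivative_at)
    ultimately have "speed f \<gamma> integrable_on {t..r}"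
      by (intro integrable_spike_finite[where S = "{t, r}" and g = "speed f \<gamma>" and f = "\<lambda>x. f (\<gamma> x) * F0 (D x)"]) auto
    then show ?case using append by (intro Henstock_Kurzweil_Integration.integrable_combine[where a = s and c = t and b = r]) auto
  qed
  then show ?thesis ..
qed

text \<open>The calibration principle: integrate the domination of the derivative by the integrand.
  All lower bounds on lengths below come from a suitable choice of \<Theta>.\<close>

lemma length_lower_bound:
  assumes "piecewise_smooth \<gamma> s t" "continuous_on UNIV f"
    and "finite S" "continuous_on {s..t} \<Theta>"
    and der: "\<And>x v. \<lbrakk>x \<in> {s<..<t} - S; (\<gamma> has_vector_derivative v) (at x)\<rbrakk> \<Longrightarrow>
      \<exists>d. (\<Theta> has_real_derivative d) (at x) \<and> d \<le> f (\<gamma> x) * F0 v"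
  shows "\<Theta> t - \<Theta> s \<le> finsler_length (\<lambda>x y. f x * F0 y) \<gamma> s t"
proof -
  obtain S' where S': "finite S'"
    "\<And>x. x \<in> {s<..<t} - S' \<Longrightarrow> (\<gamma> has_vector_derivative vector_derivative \<gamma> (at x)) (at x)"
    using piecewise_smooth_derivative[OF assms(1)] by metis
  define Z where "Z = insert s (insert t (S \<union> S'))"
  have Z: "finite Z" using S' assms by (simp add: Z_def)
  have d: "(\<Theta> has_real_derivative deriv \<Theta> x) (at x) \<and> deriv \<Theta> x \<le> speed f \<gamma> x" if "x \<in> {s..t} - Z" for x
    using der[of x "vector_derivative \<gamma> (at x)"] S'(2)[of x] that
    by (auto simp: Z_def speed_def DERIV_imp_deriv)
  have "(deriv \<Theta> has_integral \<Theta> t - \<Theta> s) {s..t}"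
    by (rule fundamental_theorem_of_calculus_interior_strong[OF Z])
      (use d assms(4) piecewise_smooth_le[OF assms(1)] in
        \<open>auto simp: has_real_derivative_iff_has_vector_derivative[symmetric]\<close>)
  \<comment> \<open>On the finite set \<open>Z\<close> the derivative is replaced by the speed
    itself, so that the comparison of integrands holds at every point.\<close>
  then have "((\<lambda>x. if x \<in> Z then speed f \<gamma> x else deriv \<Theta> x) has_integral \<Theta> t - \<Theta> s) {s..t}"
    by (rule has_integral_spike_finite[rotated 2]) (use Z in auto)
  moreover have "(speed f \<gamma> has_integral integral {s..t} (speed f \<gamma>)) {s..t}"
    using speed_integrable[OF assms(1,2)] by (rule integrable_integral)
  ultimately show ?thesis
    unfolding finsler_length_speed by (rule has_integral_le) (use d in auto)
qed

section \<open>Comparison paths with at most two edges\<close>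

lemma smooth_affine:
  assumes "\<And>x. x \<in> {a..b} \<Longrightarrow> \<gamma> x = p + x *\<^sub>R v"
  shows "smooth_on_interval \<gamma> a b"
  unfolding smooth_on_interval_def
proof (intro exI[of _ "\<lambda>n x. if n = 0 then p + x *\<^sub>R v else if n = 1 then v else 0"] conjI allI ballI)
  fix n x
  show "((\<lambda>x. if n = 0 then p + x *\<^sub>R v else if n = 1 then v else 0) has_vector_derivative
      (if Suc n = 0 then p + x *\<^sub>R v else if Suc n = 1 then v else 0)) (at x within {a..b})"
    by (cases "n = 0"; cases "n = 1") (auto intro!: derivative_eq_intros)
qed (use assms in auto)

text \<open>The path along u up to the parameter l and along v from there on; \<open>min\<close> and
  \<open>max\<close> give one formula that is evidently continuous at the bend. With u = v it is a
  straight line.\<close>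

definition elbow :: "plane \<Rightarrow> plane \<Rightarrow> plane \<Rightarrow> real \<Rightarrow> real \<Rightarrow> plane" where
  "elbow p u v l x = p + min x l *\<^sub>R u + max 0 (x - l) *\<^sub>R v"

lemma continuous_elbow: "continuous_on A (elbow p u v l)"
  unfolding elbow_def by (intro continuous_intros)

text \<open>Both edges are traversed with \<open>F0\<close>-speed 1, so the length of the elbow is
  the integral of f along it.\<close>

lemma finsler_dist_le_elbow:
  assumes "continuous_on UNIV f" "\<And>x. 0 < f x" "0 \<le> l" "0 \<le> k" "F0 u = 1" "F0 v = 1"
  shows "finsler_dist (\<lambda>x y. f x * F0 y) p (p + l *\<^sub>R u + k *\<^sub>R v)
    \<le> integral {0..l + k} (\<lambda>x. f (elbow p u v l x))"
proof -
  let ?c = "elbow p u v l"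
  have sm1: "smooth_on_interval ?c 0 l" by (rule smooth_affine[of _ _ _ p u]) (auto simp: elbow_def)
  have sm2: "smooth_on_interval ?c l (l + k)"
    by (rule smooth_affine[of _ _ _ "p + l *\<^sub>R (u - v)" v]) (auto simp: elbow_def algebra_simps)
  \<comment> \<open>Pieces of a piecewise smooth path are nondegenerate, hence the separate
    treatment of an empty edge.\<close>
  have "piecewise_smooth ?c 0 l"
    using sm1 assms(3) piecewise_smooth_append[OF piecewise_smooth_refl, of 0 l ?c] piecewise_smooth_refl[of ?c 0]
    by (cases "l = 0") auto
  then have pws: "piecewise_smooth ?c 0 (l + k)"
    using sm2 assms(4) piecewise_smooth_append[of ?c 0 l "l + k"] by (cases "k = 0") auto
  have spd: "speed f ?c x = f (?c x)" if "x \<noteq> l" for x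
  proof (cases "x < l")
    case True
    have "((\<lambda>x. p + x *\<^sub>R u) has_vector_derivative u) (at x)" by (auto intro!: derivative_eq_intros)
    then have "(?c has_vector_derivative u) (at x)"
      by (rule has_vector_derivative_transform_within_open[of _ _ _ "{..<l}"])
        (use True in \<open>auto simp: elbow_def\<close>)
    then show ?thesis by (simp add: speed_def vector_derivative_at assms)
  next
    case False
    have "((\<lambda>x. p + l *\<^sub>R (u - v) + x *\<^sub>R v) has_vector_derivative v) (at x)"
      by (auto intro!: derivative_eq_intros)
    then have "(?c has_vector_derivative v) (at x)"
      by (rule has_vector_derivative_transform_within_open[of _ _ _ "{l<..}"])
        (use False that in \<open>auto simp: elbow_def algebra_simps\<close>)
    then show ?thesis by (simp add: speed_def vector_derivative_at assms)
  qed
  have "finsler_length (\<lambda>x y. f x * F0 y) ?c 0 (l + k) = integral {0..l + k} (\<lambda>x. f (?c x))"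
    unfolding finsler_length_speed by (rule integral_spike[of "{l}"]) (use spd in auto)
  moreover have "finsler_dist (\<lambda>x y. f x * F0 y) p (p + l *\<^sub>R u + k *\<^sub>R v)
      \<le> finsler_length (\<lambda>x y. f x * F0 y) ?c 0 (l + k)"
    unfolding finsler_dist_def
  proof (rule cInf_lower)
    show "finsler_length (\<lambda>x y. f x * F0 y) ?c 0 (l + k) \<in>
      {finsler_length (\<lambda>x y. f x * F0 y) \<gamma> s t |\<gamma> s t.
        piecewise_smooth \<gamma> s t \<and> \<gamma> s = p \<and> \<gamma> t = p + l *\<^sub>R u + k *\<^sub>R v}"
      using pws assms(3,4) by (intro CollectI exI[of _ ?c] exI[of _ 0] exI[of _ "l + k"]) (auto simp: elbow_def)
    \<comment> \<open>Lengths are nonnegative, which makes the infimum a genuine lower bound of the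
      set.\<close>
    have "0 \<le> finsler_length (\<lambda>x y. f x * F0 y) \<gamma> s t" if "piecewise_smooth \<gamma> s t" for \<gamma> s t
      unfolding finsler_length_speed
      by (rule integral_nonneg[OF speed_integrable[OF that assms(1)]])
        (simp add: speed_def F0_nonneg assms(2) less_imp_le)
    then show "bdd_below {finsler_length (\<lambda>x y. f x * F0 y) \<gamma> s t |\<gamma> s t.
        piecewise_smooth \<gamma> s t \<and> \<gamma> s = p \<and> \<gamma> t = p + l *\<^sub>R u + k *\<^sub>R v}"
      by (intro bdd_belowI[of _ 0]) auto
  qed
  ultimately show ?thesis by simp
qed

section \<open>Straight segments minimize\<close>

text \<open>An antiderivative on the whole line, because it will be evaluated at shifted parameters
  whose range is not controlled.\<close>

lemma continuous_has_antiderivative: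
  fixes g :: "real \<Rightarrow> real"
  assumes "continuous_on UNIV g"
  obtains H where "\<And>x. (H has_real_derivative g x) (at x)"
proof -
  have "\<exists>F. \<forall>x::real. -\<infinity> < ereal x \<longrightarrow> ereal x < \<infinity> \<longrightarrow> (F has_vector_derivative g x) (at x)"
    by (rule einterval_antiderivative) (use assms in \<open>auto simp: continuous_on_eq_continuous_within\<close>)
  then show thesis
    using that by (auto simp: has_real_derivative_iff_has_vector_derivative)
qed

lemma updirs_unit: "d \<in> updirs \<Longrightarrow> F0 (clock d) = 1" "d \<in> updirs \<Longrightarrow> F0 (- clock d) = 1"
  by (auto simp: updirs_def F0_eq clock_values hexnorm_def field_simps max_def)

lemma updirs_norm: "d \<in> updirs \<Longrightarrow> inner (clock d) (clock d) = 1"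
  by (auto simp: updirs_def clock_values)

lemma updirs_perp: "d \<in> updirs \<Longrightarrow> inner (perp (clock d)) (clock d) = 0"
  by (auto simp: updirs_def clock_values perp_def)

lemma updirs_decomp:
  "d \<in> updirs \<Longrightarrow> z = inner (clock d) z *\<^sub>R clock d + inner (perp (clock d)) z *\<^sub>R perp (clock d)"
  by (cases z) (auto simp: updirs_def clock_values perp_def field_simps)

text \<open>A majorant of |Y| that is 1-Lipschitz in Y and differentiable also where Y
  vanishes.\<close>

lemma smoothed_abs_derivative:
  fixes Y :: "real \<Rightarrow> real"
  assumes "(Y has_real_derivative y') (at x)" "0 < \<delta>"
  obtains e where "((\<lambda>x. sqrt ((Y x)\<^sup>2 + \<delta>\<^sup>2)) has_real_derivative e) (at x)" "\<bar>e\<bar> \<le> \<bar>y'\<bar>"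
proof
  have p: "0 < (Y x)\<^sup>2 + \<delta>\<^sup>2" using assms(2) by (simp add: add_nonneg_pos)
  show "((\<lambda>x. sqrt ((Y x)\<^sup>2 + \<delta>\<^sup>2)) has_real_derivative Y x / sqrt ((Y x)\<^sup>2 + \<delta>\<^sup>2) * y') (at x)"
    using p by (auto intro!: derivative_eq_intros assms(1) simp: field_simps)
  have "\<bar>Y x\<bar> \<le> sqrt ((Y x)\<^sup>2 + \<delta>\<^sup>2)" by (rule real_le_rsqrt) simp
  then have "\<bar>Y x / sqrt ((Y x)\<^sup>2 + \<delta>\<^sup>2)\<bar> \<le> 1" using p by (simp add: abs_divide)
  then show "\<bar>Y x / sqrt ((Y x)\<^sup>2 + \<delta>\<^sup>2) * y'\<bar> \<le> \<bar>y'\<bar>"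
    unfolding abs_mult by (rule mult_left_le_one_le[rotated 2]) auto
qed

text \<open>The monotonicity of f in the form used from here on: the angle \<theta> enters only
  through the half-width \<eta> of thin cones around the upward vertices.\<close>

locale cone_decreasing =
  fixes f :: "plane \<Rightarrow> real" and \<eta> :: real
  assumes cont: "continuous_on UNIV f"
    and pos: "\<And>x. 0 < f x"
    and eta: "0 < \<eta>"
    and decr: "\<And>d z r \<beta>. \<lbrakk>d \<in> updirs; 0 < r; \<bar>\<beta>\<bar> \<le> \<eta> * r\<rbrakk> \<Longrightarrow>
      f (z + r *\<^sub>R clock d + \<beta> *\<^sub>R perp (clock d)) < f z"
begin

abbreviation F :: "plane \<Rightarrow> plane \<Rightarrow> real" where
  "F \<equiv> \<lambda>x y. f x * F0 y"

text \<open>The relative oscillation of f tolerated along a short path. With this value, the gain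
  from shifting along the line by |Y| / \<eta> is at most half of the transverse cost |Y| / sqrt
  3.\<close>

definition slack :: real where
  "slack = \<eta> / (2 * sqrt 3)"

lemma slack_pos: "0 < slack" using eta by (simp add: slack_def)

text \<open>Below, \<open>X\<close> and \<open>Y\<close> are the coordinates along and across the line, \<open>e\<close> is the derivative of a
  smoothed \<open>\<bar>Y\<bar>\<close>, and \<open>t\<close> leaves room for a multiple of \<open>Y\<close>, which gives strictness off the line.\<close>

lemma calibration_bound:
  fixes X' Y' e m h a s :: real
  assumes "\<bar>e\<bar> \<le> \<bar>Y'\<bar>" "0 \<le> h" "m + h \<le> a" "a \<le> m * (1 + slack)" "0 < m"
    "s = 1 \<or> s = -1" "\<bar>t\<bar> \<le> m / (2 * sqrt 3)"
  shows "s * (m * X' + h * (X' + e / \<eta>)) + t * Y' \<le> a * (\<bar>X'\<bar> + \<bar>Y'\<bar> / sqrt 3)"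
proof -
  have "s * ((m + h) * X') \<le> (m + h) * \<bar>X'\<bar>"
    using assms(2,5,6) by (auto simp: abs_if intro: mult_left_mono)
  also have "\<dots> \<le> a * \<bar>X'\<bar>" using assms(3) by (intro mult_right_mono) auto
  finally have 1: "s * ((m + h) * X') \<le> a * \<bar>X'\<bar>" .
  have "s * (h * e / \<eta>) \<le> \<bar>h * e / \<eta>\<bar>"
    using assms(6) by (elim disjE) (simp_all only: mult_1 mult_minus_left abs_ge_self abs_ge_minus_self)
  also have "\<dots> = h * \<bar>e\<bar> / \<eta>" using assms(2) eta by (simp add: abs_mult)
  also have "\<dots> \<le> (m * slack) * \<bar>Y'\<bar> / \<eta>"
    using assms eta by (intro divide_right_mono mult_mono) (auto simp: algebra_simps)
  also have "\<dots> = m / (2 * sqrt 3) * \<bar>Y'\<bar>" using eta by (simp add: slack_def)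
  finally have 2: "s * (h * e / \<eta>) \<le> m / (2 * sqrt 3) * \<bar>Y'\<bar>" .
  have "t * Y' \<le> \<bar>t\<bar> * \<bar>Y'\<bar>" by (metis abs_ge_self abs_mult)
  also have "\<dots> \<le> m / (2 * sqrt 3) * \<bar>Y'\<bar>" using assms(7) by (rule mult_right_mono) auto
  finally have 3: "t * Y' \<le> m / (2 * sqrt 3) * \<bar>Y'\<bar>" .
  \<comment> \<open>The transverse cost is spent in two halves, one on the oscillation of f and one
    on the multiple of \<open>Y'\<close>.\<close>
  have "m / (2 * sqrt 3) * \<bar>Y'\<bar> + m / (2 * sqrt 3) * \<bar>Y'\<bar> = m * (\<bar>Y'\<bar> / sqrt 3)" by (simp add: field_simps)
  also have "\<dots> \<le> a * (\<bar>Y'\<bar> / sqrt 3)" using assms(2,3) by (intro mult_right_mono) auto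
  finally have 4: "m / (2 * sqrt 3) * \<bar>Y'\<bar> + m / (2 * sqrt 3) * \<bar>Y'\<bar> \<le> a * (\<bar>Y'\<bar> / sqrt 3)" .
  have "s * (m * X' + h * (X' + e / \<eta>)) = s * ((m + h) * X') + s * (h * e / \<eta>)"
    by (simp add: algebra_simps)
  moreover have "a * (\<bar>X'\<bar> + \<bar>Y'\<bar> / sqrt 3) = a * \<bar>X'\<bar> + a * (\<bar>Y'\<bar> / sqrt 3)"
    by (rule distrib_left)
  ultimately show ?thesis using 1 2 3 4 by linarith
qed

text \<open>The calibration of a segment, with \<sigma> for its orientation. The range of f is known
  only on \<gamma>, not on the line, so f is truncated from below by m there; this keeps h
  nonnegative. The term in \<open>x0\<close> penalizes leaving the line.\<close>

lemma straight_length_bound: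
  assumes pws: "piecewise_smooth \<gamma> s t"
    and rng: "\<And>x. x \<in> {s..t} \<Longrightarrow> m \<le> f (\<gamma> x) \<and> f (\<gamma> x) \<le> m * (1 + slack)" and m: "0 < m"
    and d: "d \<in> updirs" and sg: "\<sigma> = 1 \<or> \<sigma> = -1" and x0: "x0 \<in> {s..t}"
    and fin: "\<gamma> t = \<gamma> s + T *\<^sub>R clock d"
    and H: "\<And>x. (H has_real_derivative max m (f (\<gamma> s + x *\<^sub>R clock d))) (at x)"
  shows "\<sigma> * (H T - H 0) + m / sqrt 3 * \<bar>inner (perp (clock d)) (\<gamma> x0 - \<gamma> s)\<bar> \<le> finsler_length F \<gamma> s t"
    (is "?l \<le> ?len")
proof -
  define u n where "u = clock d" and "n = perp (clock d)"
  define X Y where "X x = inner u (\<gamma> x - \<gamma> s)" and "Y x = inner n (\<gamma> x - \<gamma> s)" for x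
  define K where "K = 1 / \<eta>"
  have st: "s \<le> t" using pws by (rule piecewise_smooth_le)
  have contg: "continuous_on {s..t} \<gamma>" using pws by (rule piecewise_smooth_continuous)
  have contX: "continuous_on {s..t} X" and contY: "continuous_on {s..t} Y"
    unfolding X_def Y_def by (intro continuous_intros contg)+
  have contH: "continuous_on UNIV H" using H by (meson DERIV_continuous_on DERIV_subset subset_UNIV)
  have XYt: "X s = 0" "Y s = 0" "X t = T" "Y t = 0"
    using updirs_norm[OF d] updirs_perp[OF d] by (auto simp: X_def Y_def fin u_def n_def)
  define h where "h x = max m (f (\<gamma> s + x *\<^sub>R u)) - m" for x
  define H' where "H' x = H x - m * x" for x
  have H': "(H' has_real_derivative h x) (at x)" for x
    unfolding H'_def h_def u_def by (auto intro!: derivative_eq_intros H)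
  \<comment> \<open>The bound up to an error from the smoothing parameter \<delta>, which is sent to
    0 at the end.\<close>
  have bound: "\<sigma> * (m * T + H' (T + K * \<delta>) - H' (K * \<delta>)) + m / sqrt 3 * \<bar>Y x0\<bar> \<le> ?len" if dl: "0 < \<delta>" for \<delta>
  proof -
    \<comment> \<open>The half of the transverse cost that is still available, signed so that c * Y
      x0 is nonnegative.\<close>
    define c where "c = m / (2 * sqrt 3) * sgn (Y x0)"
    \<comment> \<open>Using \<open>sqrt (Y\<^sup>2 + \<delta>\<^sup>2) > \<bar>Y\<bar>\<close> instead of \<open>\<bar>Y\<bar>\<close> keeps \<open>S\<close> differentiable and, \<open>f\<close> decreasing along
      the line, only lowers \<open>h (S x)\<close>.\<close>
    define S where "S x = X x + K * sqrt ((Y x)\<^sup>2 + \<delta>\<^sup>2)" for x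
    \<comment> \<open>The last summand is reflected at \<open>x0\<close>: as Y vanishes at both
      ends, it increases by 2 * c * Y x0 in total.\<close>
    define \<Theta> where "\<Theta> x = \<sigma> * (m * X x + H' (S x)) + (if x \<le> x0 then c * Y x else 2 * (c * Y x0) - c * Y x)" for x
    have "\<Theta> t - \<Theta> s \<le> ?len"
    proof (rule length_lower_bound[OF pws cont, of "{x0}"])
      have cs: "continuous_on {s..t} S" unfolding S_def by (intro continuous_intros contX contY)
      have c1: "continuous_on {s..t} (\<lambda>x. if x \<le> x0 then c * Y x else 2 * (c * Y x0) - c * Y x)"
        by (rule continuous_on_cases_le)
          (auto intro!: continuous_intros continuous_on_subset[OF contY])
      have c2: "continuous_on {s..t} (\<lambda>x. H' (S x))"
        unfolding H'_def by (intro continuous_intros continuous_on_compose2[OF contH cs] cs) auto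
      show "continuous_on {s..t} \<Theta>"
        unfolding \<Theta>_def by (intro continuous_intros c1 c2 contX)
      fix x v assume x: "x \<in> {s<..<t} - {x0}" and v: "(\<gamma> has_vector_derivative v) (at x)"
      have dX: "(X has_real_derivative inner u v) (at x)" and dY: "(Y has_real_derivative inner n v) (at x)"
        unfolding X_def Y_def has_real_derivative_iff_has_vector_derivative inner_diff_right
        by (auto intro!: derivative_eq_intros bounded_linear.has_vector_derivative[OF bounded_linear_inner_right v])
      obtain e where e: "((\<lambda>x. sqrt ((Y x)\<^sup>2 + \<delta>\<^sup>2)) has_real_derivative e) (at x)" "\<bar>e\<bar> \<le> \<bar>inner n v\<bar>"
        using smoothed_abs_derivative[OF dY dl] by metis
      have dS: "(S has_real_derivative inner u v + e / \<eta>) (at x)"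
        unfolding S_def using DERIV_add[OF dX DERIV_cmult[OF e(1), of K]] by (simp add: K_def)
      define \<tau> where "\<tau> = (if x < x0 then c else - c)"
      have dtent: "((\<lambda>x. if x \<le> x0 then c * Y x else 2 * (c * Y x0) - c * Y x) has_real_derivative \<tau> * inner n v) (at x)"
      proof (cases "x < x0")
        case True
        have "((\<lambda>x. c * Y x) has_real_derivative \<tau> * inner n v) (at x)"
          using True by (auto intro!: derivative_eq_intros dY simp: \<tau>_def)
        then show ?thesis
          by (rule has_field_derivative_transform_within_open[of _ _ _ "{..<x0}"]) (use True in auto)
      next
        case False
        have "((\<lambda>x. 2 * (c * Y x0) - c * Y x) has_real_derivative \<tau> * inner n v) (at x)"
          using False by (auto intro!: derivative_eq_intros dY simp: \<tau>_def)
        then show ?thesis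
          by (rule has_field_derivative_transform_within_open[of _ _ _ "{x0<..}"]) (use False x in auto)
      qed
      have dT: "(\<Theta> has_real_derivative
          \<sigma> * (m * inner u v + h (S x) * (inner u v + e / \<eta>)) + \<tau> * inner n v) (at x)"
        unfolding \<Theta>_def
        by (rule derivative_eq_intros dX dtent DERIV_chain2[OF H'] dS refl | simp)+
      \<comment> \<open>The point of the line at the parameter S x lies in the thin cone at \<gamma>
        x, since S x - X x exceeds |Y x| / \<eta>.\<close>
      have "f (\<gamma> s + S x *\<^sub>R u) < f (\<gamma> x)"
      proof -
        have r: "\<bar>Y x\<bar> < sqrt ((Y x)\<^sup>2 + \<delta>\<^sup>2)"
          using dl by (intro real_less_rsqrt) auto
        then have r0: "0 < sqrt ((Y x)\<^sup>2 + \<delta>\<^sup>2)" by linarith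
        have p: "0 < S x - X x" "\<bar>- Y x\<bar> \<le> \<eta> * (S x - X x)"
          using r r0 eta by (auto simp: S_def K_def)
        have "\<gamma> x - \<gamma> s = X x *\<^sub>R u + Y x *\<^sub>R n"
          unfolding X_def Y_def u_def n_def using updirs_decomp[OF d] by blast
        then have "\<gamma> x + (S x - X x) *\<^sub>R u + (- Y x) *\<^sub>R n = \<gamma> s + S x *\<^sub>R u"
          by (simp add: algebra_simps)
        then show ?thesis using decr[OF d p, of "\<gamma> x"] by (simp add: u_def n_def)
      qed
      then have "m + h (S x) \<le> f (\<gamma> x)" using rng[of x] x by (auto simp: h_def)
      then have "\<sigma> * (m * inner u v + h (S x) * (inner u v + e / \<eta>)) + \<tau> * inner n v
          \<le> f (\<gamma> x) * (\<bar>inner u v\<bar> + \<bar>inner n v\<bar> / sqrt 3)"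
        by (intro calibration_bound e sg m)
          (use rng[of x] x m in \<open>auto simp: h_def \<tau>_def c_def abs_mult abs_sgn_eq\<close>)
      also have "\<dots> \<le> f (\<gamma> x) * F0 v"
        using F0_lower[OF d, of v] pos[of "\<gamma> x"] by (auto simp: u_def n_def)
      finally show "\<exists>d. (\<Theta> has_real_derivative d) (at x) \<and> d \<le> f (\<gamma> x) * F0 v"
        using dT by blast
    qed auto
    moreover have "\<Theta> s = \<sigma> * H' (K * \<delta>)"
      using XYt dl x0 by (simp add: \<Theta>_def S_def)
    moreover have "\<Theta> t = \<sigma> * (m * T + H' (T + K * \<delta>)) + 2 * (c * Y x0)"
      using XYt dl x0 by (auto simp: \<Theta>_def S_def)
    moreover have "2 * (c * Y x0) = m / sqrt 3 * \<bar>Y x0\<bar>"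
      by (simp add: c_def abs_sgn)
    ultimately show ?thesis by (simp add: algebra_simps)
  qed
  have contH': "isCont H' x" for x using H' by (rule DERIV_isCont)
  have "((\<lambda>\<delta>. \<sigma> * (m * T + H' (T + K * \<delta>) - H' (K * \<delta>)) + m / sqrt 3 * \<bar>Y x0\<bar>) \<longlongrightarrow>
      \<sigma> * (m * T + H' (T + K * 0) - H' (K * 0)) + m / sqrt 3 * \<bar>Y x0\<bar>) (at_right 0)"
    by (intro tendsto_intros isCont_tendsto_compose[OF contH'])
  then have "\<sigma> * (m * T + H' (T + K * 0) - H' (K * 0)) + m / sqrt 3 * \<bar>Y x0\<bar> \<le> ?len"
    by (rule tendsto_upperbound) (use eventually_mono[OF eventually_at_right_less bound] in auto)
  then show ?thesis by (simp add: H'_def Y_def n_def algebra_simps)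
qed

text \<open>The segment itself has length at most \<sigma> * (H T - H 0). A minimizing path is not
  longer, so the penalty in \<open>straight_length_bound\<close> must vanish at every
  parameter.\<close>

lemma straight_on_line:
  assumes mp: "minimizing_path F \<gamma> s t"
    and rng: "\<And>x. x \<in> {s..t} \<Longrightarrow> m \<le> f (\<gamma> x) \<and> f (\<gamma> x) \<le> m * (1 + slack)" and m: "0 < m"
    and d: "d \<in> updirs"
    and fin: "\<gamma> t = \<gamma> s + T *\<^sub>R clock d" and x: "x \<in> {s..t}"
  shows "inner (perp (clock d)) (\<gamma> x - \<gamma> s) = 0"
proof -
  have pws: "piecewise_smooth \<gamma> s t" and len: "finsler_length F \<gamma> s t = finsler_dist F (\<gamma> s) (\<gamma> t)"
    using mp by (auto simp: minimizing_path_def)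
  define g where "g x = f (\<gamma> s + x *\<^sub>R clock d)" for x
  have cg: "continuous_on UNIV g"
    unfolding g_def by (intro continuous_on_compose2[OF cont] continuous_intros) auto
  have "continuous_on UNIV (\<lambda>x. max m (g x))" by (intro continuous_intros cg)
  then obtain H where H: "\<And>x. (H has_real_derivative max m (g x)) (at x)"
    using continuous_has_antiderivative by metis
  define \<sigma> :: real where "\<sigma> = (if 0 \<le> T then 1 else -1)"
  have sg: "\<sigma> = 1 \<or> \<sigma> = -1" "T = \<sigma> * \<bar>T\<bar>" by (auto simp: \<sigma>_def)
  have F1: "F0 (\<sigma> *\<^sub>R clock d) = 1" using updirs_unit[OF d] by (simp add: \<sigma>_def)
  \<comment> \<open>The segment is an elbow whose two directions agree and whose second edge is
    empty.\<close>
  have el: "elbow (\<gamma> s) (\<sigma> *\<^sub>R clock d) (\<sigma> *\<^sub>R clock d) \<bar>T\<bar> x = \<gamma> s + (\<sigma> * x) *\<^sub>R clock d" for x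
    unfolding elbow_def add.assoc scaleR_add_left[symmetric] by (simp add: min_def max_def mult.commute)
  have T: "\<gamma> s + \<bar>T\<bar> *\<^sub>R (\<sigma> *\<^sub>R clock d) + 0 *\<^sub>R (\<sigma> *\<^sub>R clock d) = \<gamma> t"
    by (simp add: fin \<sigma>_def)
  have "finsler_dist F (\<gamma> s) (\<gamma> s + \<bar>T\<bar> *\<^sub>R (\<sigma> *\<^sub>R clock d) + 0 *\<^sub>R (\<sigma> *\<^sub>R clock d))
      \<le> integral {0..\<bar>T\<bar> + 0} (\<lambda>x. f (elbow (\<gamma> s) (\<sigma> *\<^sub>R clock d) (\<sigma> *\<^sub>R clock d) \<bar>T\<bar> x))"
    by (rule finsler_dist_le_elbow[OF cont pos]) (use F1 in auto)
  then have "finsler_length F \<gamma> s t \<le> integral {0..\<bar>T\<bar>} (\<lambda>x. g (\<sigma> * x))"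
    unfolding T el add_0_right len g_def .
  also have "\<dots> \<le> integral {0..\<bar>T\<bar>} (\<lambda>x. max m (g (\<sigma> * x)))"
    by (intro integral_le integrable_continuous_interval continuous_intros continuous_on_compose2[OF cg]) auto
  also have "\<dots> = \<sigma> * H (\<sigma> * \<bar>T\<bar>) - \<sigma> * H (\<sigma> * 0)"
  proof (rule integral_unique, rule fundamental_theorem_of_calculus)
    fix x
    have "((\<lambda>x. \<sigma> * H (\<sigma> * x)) has_real_derivative max m (g (\<sigma> * x))) (at x)"
      using sg(1) by (auto intro!: derivative_eq_intros DERIV_chain2[OF H])
    then show "((\<lambda>x. \<sigma> * H (\<sigma> * x)) has_vector_derivative max m (g (\<sigma> * x))) (at x within {0..\<bar>T\<bar>})"
      unfolding has_real_derivative_iff_has_vector_derivative by (rule has_vector_derivative_at_within)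
  qed simp
  also have "\<dots> = \<sigma> * (H T - H 0)"
    using sg(2) by (simp add: algebra_simps)
  finally have "finsler_length F \<gamma> s t \<le> \<sigma> * (H T - H 0)" .
  moreover have "\<sigma> * (H T - H 0) + m / sqrt 3 * \<bar>inner (perp (clock d)) (\<gamma> x - \<gamma> s)\<bar> \<le> finsler_length F \<gamma> s t"
    by (rule straight_length_bound[OF pws rng m d sg(1) x fin]) (use H in \<open>auto simp: g_def\<close>)
  ultimately have "m / sqrt 3 * \<bar>inner (perp (clock d)) (\<gamma> x - \<gamma> s)\<bar> \<le> 0" by linarith
  moreover have "0 < m / sqrt 3" using m by simp
  ultimately show ?thesis by (metis abs_le_zero_iff linorder_not_less mult_le_0_iff)
qed


end

section \<open>Short minimizing paths\<close>

definition dirs :: "nat set" where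
  "dirs = {0, 2, 4, 6, 8, 10}"

lemma turn_dirs: "(d, e) \<in> turn \<Longrightarrow> d \<in> dirs" "(d, e) \<in> turn \<Longrightarrow> e \<in> dirs"
  by (auto simp: turn_def dirs_def)

text \<open>p and q are the dual basis of the sector: \<open>perp (clock e)\<close> annihilates
  \<open>clock e\<close>, and dividing by its value at \<open>clock d\<close> normalizes it.\<close>

lemma turn_coordinates:
  assumes "(d, e) \<in> turn"
  obtains p q where "\<And>v. v = inner p v *\<^sub>R clock d + inner q v *\<^sub>R clock e"
    "\<And>a b. inner p (a *\<^sub>R clock d + b *\<^sub>R clock e) = a"
    "\<And>a b. inner q (a *\<^sub>R clock d + b *\<^sub>R clock e) = b"
proof -
  define p q where "p = perp (clock e) /\<^sub>R inner (perp (clock e)) (clock d)"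
    and "q = perp (clock d) /\<^sub>R inner (perp (clock d)) (clock e)"
  have "inner p (clock d) = 1 \<and> inner p (clock e) = 0 \<and> inner q (clock d) = 0 \<and> inner q (clock e) = 1"
    using assms unfolding turn_def p_def q_def by (auto simp: clock_values perp_def)
  moreover have "v = inner p v *\<^sub>R clock d + inner q v *\<^sub>R clock e" for v
    using assms unfolding turn_def p_def q_def
    by (cases v) (auto simp: clock_values perp_def field_simps)
  ultimately show thesis using that[of p q] by (simp add: inner_add_right)
qed

text \<open>Trading progress along \<open>clock e\<close> for equal progress along
  \<open>clock d\<close> moves a point upwards, to smaller values of f.\<close>

lemma turn_diff_updirs: "(d, e) \<in> turn \<Longrightarrow> \<exists>k\<in>updirs. clock d - clock e = clock k"
  by (auto simp: turn_def updirs_def clock_values)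

lemma sgn_mult_le: "sgn a * w \<le> \<bar>w\<bar>" for a w :: real
  by (auto simp: sgn_if)

definition in_sector :: "nat \<Rightarrow> nat \<Rightarrow> plane \<Rightarrow> bool" where
  "in_sector d e v \<longleftrightarrow> (\<exists>a b. 0 \<le> a \<and> 0 \<le> b \<and> v = a *\<^sub>R clock d + b *\<^sub>R clock e)"

lemma in_sector_scale: "0 \<le> r \<Longrightarrow> in_sector d e (r *\<^sub>R clock d)" "0 \<le> r \<Longrightarrow> in_sector d e (r *\<^sub>R clock e)"
  unfolding in_sector_def by (rule exI[of _ r], rule exI[of _ 0], simp) (rule exI[of _ 0], rule exI[of _ r], simp)

text \<open>Membership becomes the sign of one continuous function, to which the intermediate value
  theorem applies.\<close>

lemma in_sector_min:
  assumes "\<And>v. v = inner p v *\<^sub>R clock d + inner q v *\<^sub>R clock e"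
    "\<And>a b. inner p (a *\<^sub>R clock d + b *\<^sub>R clock e) = a"
    "\<And>a b. inner q (a *\<^sub>R clock d + b *\<^sub>R clock e) = b"
  shows "in_sector d e v \<longleftrightarrow> 0 \<le> min (inner p v) (inner q v)"
  unfolding in_sector_def by (metis assms min.boundedE min.boundedI)

lemma sector_boundary:
  assumes "\<And>v. v = inner p v *\<^sub>R clock d + inner q v *\<^sub>R clock e" "min (inner p v) (inner q v) = 0"
  obtains k T where "k \<in> {d, e}" "0 \<le> T" "v = T *\<^sub>R clock k"
proof (cases "inner p v = 0")
  case True
  then show thesis using assms that[of e "inner q v"] by (metis add_0 insertCI min.cobounded2 scaleR_zero_left)
next
  case False
  then have "inner q v = 0" "0 \<le> inner p v" using assms(2) by (auto simp: min_def split: if_splits)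
  then show thesis using assms(1)[of v] that[of d "inner p v"] by simp
qed

section \<open>Monotonicity of short minimizing paths in a sector\<close>

context cone_decreasing
begin

text \<open>The local situation in which \<open>straight_on_line\<close> applies to every subpath.
  For b < a it holds vacuously.\<close>

definition good :: "(real \<Rightarrow> plane) \<Rightarrow> real \<Rightarrow> real \<Rightarrow> bool" where
  "good \<gamma> a b \<longleftrightarrow>
     (\<forall>x y. a \<le> x \<longrightarrow> x \<le> y \<longrightarrow> y \<le> b \<longrightarrow> minimizing_path F \<gamma> x y) \<and> pauses_nowhere \<gamma> {a..b} \<and>
     (\<exists>m>0. \<forall>x\<in>{a..b}. m \<le> f (\<gamma> x) \<and> f (\<gamma> x) \<le> m * (1 + slack))"

lemma good_subinterval: "good \<gamma> a b \<Longrightarrow> a \<le> a' \<Longrightarrow> b' \<le> b \<Longrightarrow> good \<gamma> a' b'"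
  unfolding good_def pauses_nowhere_def
  by (auto 0 4 intro: order_trans)

lemma good_minimizing: "good \<gamma> a b \<Longrightarrow> a \<le> b \<Longrightarrow> minimizing_path F \<gamma> a b"
  by (simp add: good_def)

lemma good_continuous: "good \<gamma> a b \<Longrightarrow> continuous_on {a..b} \<gamma>"
  by (cases "a \<le> b") (auto simp: good_def minimizing_path_def intro: piecewise_smooth_continuous)

text \<open>A loop has distance 0 between its ends, hence length 0 if it minimizes. But it does not
  pause, so it reaches a different point, which costs positive length.\<close>

lemma good_inj:
  assumes "good \<gamma> a b"
  shows "inj_on \<gamma> {a..b}"
proof (rule linorder_inj_onI')
  fix x y assume xy: "x \<in> {a..b}" "y \<in> {a..b}" "x < y"
  show "\<gamma> x \<noteq> \<gamma> y"
  proof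
    assume eq: "\<gamma> x = \<gamma> y"
    obtain m where m: "0 < m" "\<And>x. x \<in> {a..b} \<Longrightarrow> m \<le> f (\<gamma> x)"
      using assms unfolding good_def by blast
    have mp: "minimizing_path F \<gamma> x y" using good_minimizing[OF good_subinterval[OF assms]] xy by auto
    obtain z where z: "z \<in> {x..y}" "\<gamma> z \<noteq> \<gamma> x"
      using assms xy unfolding good_def pauses_nowhere_def by blast
    have "piecewise_smooth \<gamma> x z"
      using good_minimizing[OF good_subinterval[OF assms]] xy z by (auto simp: minimizing_path_def)
    note pws = this
    \<comment> \<open>Of the two coordinate functionals, at least one separates the points, and both
      are dominated by \<open>sqrt 3\<close> times \<open>F0\<close>.\<close>
    have "\<exists>q. inner q (\<gamma> z - \<gamma> x) \<noteq> 0 \<and> (\<forall>v. \<bar>inner q v\<bar> / sqrt 3 \<le> F0 v)"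
    proof -
      have 0: "0 \<in> updirs" by (simp add: updirs_def)
      have "\<bar>inner (clock 0) v\<bar> / sqrt 3 \<le> \<bar>inner (clock 0) v\<bar>" for v
        by (auto simp: divide_le_eq intro!: mult_left_mono[of 1 "sqrt 3", simplified])
      then have "\<bar>inner (clock 0) v\<bar> / sqrt 3 \<le> F0 v" for v
        using F0_lower[OF 0, of v] by (smt (verit) divide_nonneg_nonneg real_sqrt_ge_zero)
      moreover have "\<bar>inner (perp (clock 0)) v\<bar> / sqrt 3 \<le> F0 v" for v
        using F0_lower[OF 0, of v] by linarith
      moreover have "inner (clock 0) (\<gamma> z - \<gamma> x) \<noteq> 0 \<or> inner (perp (clock 0)) (\<gamma> z - \<gamma> x) \<noteq> 0"
        using updirs_decomp[OF 0, of "\<gamma> z - \<gamma> x"] z(2) by auto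
      ultimately show ?thesis by blast
    qed
    then obtain q where q: "inner q (\<gamma> z - \<gamma> x) \<noteq> 0" "\<And>v. \<bar>inner q v\<bar> / sqrt 3 \<le> F0 v" by blast
    define c where "c = m * (sgn (inner q (\<gamma> z - \<gamma> x)) / sqrt 3)"
    have "c * inner q (\<gamma> z) - c * inner q (\<gamma> x) \<le> finsler_length F \<gamma> x z"
    proof (rule length_lower_bound[OF pws cont, of "{}"])
      show "continuous_on {x..z} (\<lambda>x. c * inner q (\<gamma> x))"
        using piecewise_smooth_continuous[OF pws] by (intro continuous_intros)
      fix t v assume t: "t \<in> {x<..<z} - {}" and v: "(\<gamma> has_vector_derivative v) (at t)"
      have "((\<lambda>x. c * inner q (\<gamma> x)) has_real_derivative c * inner q v) (at t)"
        unfolding has_real_derivative_iff_has_vector_derivative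
        by (auto intro!: derivative_eq_intros bounded_linear.has_vector_derivative[OF bounded_linear_inner_right v])
      moreover have "c * inner q v \<le> f (\<gamma> t) * F0 v"
      proof -
        have "sgn (inner q (\<gamma> z - \<gamma> x)) / sqrt 3 * inner q v \<le> \<bar>inner q v\<bar> / sqrt 3"
          using divide_right_mono[OF sgn_mult_le, of "sqrt 3"] by simp
        also have "\<dots> \<le> F0 v" by (rule q)
        finally have "m * (sgn (inner q (\<gamma> z - \<gamma> x)) / sqrt 3 * inner q v) \<le> m * F0 v"
          using m by (intro mult_left_mono) auto
        also have "\<dots> \<le> f (\<gamma> t) * F0 v"
          using m(2)[of t] t xy z(1) F0_nonneg by (intro mult_right_mono) auto
        finally show ?thesis by (simp add: c_def mult.assoc)
      qed
      ultimately show "\<exists>d. ((\<lambda>x. c * inner q (\<gamma> x)) has_real_derivative d) (at t) \<and> d \<le> f (\<gamma> t) * F0 v" by blast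
    qed auto
    also have "\<dots> \<le> finsler_length F \<gamma> x y"
      unfolding finsler_length_speed
      by (rule integral_subset_le)
        (use z speed_integrable[OF _ cont] pws mp in
          \<open>auto simp: minimizing_path_def speed_def F0_nonneg pos less_imp_le\<close>)
    \<comment> \<open>The distance of a point to itself is bounded by an elbow with two empty
      edges.\<close>
    also have "\<dots> = finsler_dist F (\<gamma> x) (\<gamma> x + 0 *\<^sub>R clock 0 + 0 *\<^sub>R clock 0)"
      using mp eq by (simp add: minimizing_path_def)
    also have "\<dots> \<le> integral {0..0 + 0} (\<lambda>t. f (elbow (\<gamma> x) (clock 0) (clock 0) 0 t))"
      by (rule finsler_dist_le_elbow[OF cont pos]) (auto intro: updirs_unit simp: updirs_def)
    also have "\<dots> = 0" by simp
    finally have "c * inner q (\<gamma> z - \<gamma> x) \<le> 0" by (simp add: inner_diff_right right_diff_distrib)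
    moreover have "c * inner q (\<gamma> z - \<gamma> x) = m / sqrt 3 * \<bar>inner q (\<gamma> z - \<gamma> x)\<bar>"
      by (simp add: c_def abs_sgn)
    moreover have "\<dots> > 0" using m q(1) by simp
    ultimately show False by linarith
  qed
qed

text \<open>On the line, the path is a continuous injective real function, hence monotone, and stays
  between its ends.\<close>

lemma good_line:
  assumes "good \<gamma> s t" "x \<in> {s..t}" "d \<in> updirs" "\<gamma> t = \<gamma> s + T *\<^sub>R clock d"
  obtains r where "\<gamma> x = \<gamma> s + r *\<^sub>R clock d" "0 \<le> r \<and> r \<le> T \<or> T \<le> r \<and> r \<le> 0"
proof -
  have st: "s \<le> t" using assms(2) by auto
  obtain m where m: "0 < m" "\<And>x. x \<in> {s..t} \<Longrightarrow> m \<le> f (\<gamma> x) \<and> f (\<gamma> x) \<le> m * (1 + slack)"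
    using assms(1) unfolding good_def by blast
  have line: "\<gamma> y = \<gamma> s + inner (clock d) (\<gamma> y - \<gamma> s) *\<^sub>R clock d" if "y \<in> {s..t}" for y
    using straight_on_line[OF good_minimizing[OF assms(1) st] m(2) m(1) assms(3,4) that]
      updirs_decomp[OF assms(3), of "\<gamma> y - \<gamma> s"] by simp
  define X where "X y = inner (clock d) (\<gamma> y - \<gamma> s)" for y
  have cX: "continuous_on {s..t} X"
    unfolding X_def by (intro continuous_intros good_continuous[OF assms(1)])
  have iX: "inj_on X {s..t}"
    using good_inj[OF assms(1)] line unfolding inj_on_def X_def by metis
  have "X s = 0" "X t = T" using updirs_norm[OF assms(3)] by (auto simp: X_def assms(4))
  then have "0 \<le> X x \<and> X x \<le> T \<or> T \<le> X x \<and> X x \<le> 0"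
    using continuous_inj_imp_mono[OF _ _ cX iX, of x] assms(2)
    by (cases "x = s"; cases "x = t") auto
  then show thesis using that[of "X x"] line[OF assms(2)] by (simp add: X_def)
qed

lemma good_ray:
  assumes "good \<gamma> s t" "x \<in> {s..t}" "d \<in> dirs" "\<gamma> t = \<gamma> s + T *\<^sub>R clock d" "0 \<le> T"
  obtains r where "\<gamma> x = \<gamma> s + r *\<^sub>R clock d" "0 \<le> r" "r \<le> T"
proof -
  have "d \<in> updirs \<or> (\<exists>e\<in>updirs. clock d = - clock e)"
    using assms(3) by (auto simp: dirs_def updirs_def clock_values)
  then show thesis
  proof
    assume "d \<in> updirs"
    then show thesis using good_line[OF assms(1,2) _ assms(4)] that assms(5) by (metis order_antisym order_trans)
  next
    assume "\<exists>e\<in>updirs. clock d = - clock e"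
    then obtain e where e: "e \<in> updirs" "clock d = - clock e" by blast
    then have "\<gamma> t = \<gamma> s + (- T) *\<^sub>R clock e" using assms(4) by simp
    from good_line[OF assms(1,2) e(1) this] obtain r where
      "\<gamma> x = \<gamma> s + r *\<^sub>R clock e" "0 \<le> r \<and> r \<le> - T \<or> - T \<le> r \<and> r \<le> 0" .
    then show thesis using that[of "- r"] e(2) assms(5) by auto
  qed
qed

text \<open>If x violates this, then by continuity some earlier y sees the end in a boundary
  direction. From y on the path is a straight segment in this direction, and x lies on it: a
  contradiction.\<close>

lemma sector_from_end:
  assumes "good \<gamma> s t" "(d, e) \<in> turn" "in_sector d e (\<gamma> t - \<gamma> s)" "x \<in> {s..t}"
  shows "in_sector d e (\<gamma> t - \<gamma> x)"
proof (rule ccontr)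
  obtain p q where pq: "\<And>v. v = inner p v *\<^sub>R clock d + inner q v *\<^sub>R clock e"
    "\<And>a b. inner p (a *\<^sub>R clock d + b *\<^sub>R clock e) = a"
    "\<And>a b. inner q (a *\<^sub>R clock d + b *\<^sub>R clock e) = b"
    using turn_coordinates[OF assms(2)] by metis
  note sec = in_sector_min[OF pq]
  define \<phi> where "\<phi> y = min (inner p (\<gamma> t - \<gamma> y)) (inner q (\<gamma> t - \<gamma> y))" for y
  assume not: "\<not> in_sector d e (\<gamma> t - \<gamma> x)"
  have "continuous_on {s..x} \<phi>"
    unfolding \<phi>_def using assms(4) good_continuous[OF assms(1)]
    by (intro continuous_intros) (auto intro: continuous_on_subset)
  moreover have "\<phi> x \<le> 0" "0 \<le> \<phi> s" using not assms(3) by (auto simp: sec \<phi>_def)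
  ultimately obtain y where y: "s \<le> y" "y \<le> x" "\<phi> y = 0"
    using IVT2'[of \<phi> x 0 s] assms(4) by auto
  obtain k T where k: "k \<in> {d, e}" "0 \<le> T" "\<gamma> t - \<gamma> y = T *\<^sub>R clock k"
    using sector_boundary[OF pq(1)] y(3) unfolding \<phi>_def by metis
  have "k \<in> dirs" using k(1) turn_dirs[OF assms(2)] by auto
  then obtain r where r: "\<gamma> x = \<gamma> y + r *\<^sub>R clock k" "0 \<le> r" "r \<le> T"
    using good_ray[OF good_subinterval[OF assms(1) y(1) order_refl], of x k T] y(2) assms(4) k
    by (auto simp: algebra_simps)
  then have "\<gamma> t - \<gamma> x = (T - r) *\<^sub>R clock k" using k(3) by (simp add: algebra_simps)
  then show False using not k(1) r(3) by (auto simp: in_sector_scale)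
qed

text \<open>The same argument as in \<open>sector_from_end\<close>, with a boundary point y after
  x.\<close>

lemma sector_from_start:
  assumes "good \<gamma> s t" "(d, e) \<in> turn" "in_sector d e (\<gamma> t - \<gamma> s)" "x \<in> {s..t}"
  shows "in_sector d e (\<gamma> x - \<gamma> s)"
proof (rule ccontr)
  obtain p q where pq: "\<And>v. v = inner p v *\<^sub>R clock d + inner q v *\<^sub>R clock e"
    "\<And>a b. inner p (a *\<^sub>R clock d + b *\<^sub>R clock e) = a"
    "\<And>a b. inner q (a *\<^sub>R clock d + b *\<^sub>R clock e) = b"
    using turn_coordinates[OF assms(2)] by metis
  note sec = in_sector_min[OF pq]
  define \<phi> where "\<phi> y = min (inner p (\<gamma> y - \<gamma> s)) (inner q (\<gamma> y - \<gamma> s))" for y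
  assume not: "\<not> in_sector d e (\<gamma> x - \<gamma> s)"
  have "continuous_on {x..t} \<phi>"
    unfolding \<phi>_def using assms(4) good_continuous[OF assms(1)]
    by (intro continuous_intros) (auto intro: continuous_on_subset)
  moreover have "\<phi> x \<le> 0" "0 \<le> \<phi> t" using not assms(3) by (auto simp: sec \<phi>_def)
  ultimately obtain y where y: "x \<le> y" "y \<le> t" "\<phi> y = 0"
    using IVT'[of \<phi> x 0 t] assms(4) by auto
  obtain k T where k: "k \<in> {d, e}" "0 \<le> T" "\<gamma> y - \<gamma> s = T *\<^sub>R clock k"
    using sector_boundary[OF pq(1)] y(3) unfolding \<phi>_def by metis
  have "k \<in> dirs" using k(1) turn_dirs[OF assms(2)] by auto
  then obtain r where r: "\<gamma> x = \<gamma> s + r *\<^sub>R clock k" "0 \<le> r" "r \<le> T"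
    using good_ray[OF good_subinterval[OF assms(1) order_refl y(2)], of x k T] y(1) assms(4) k
    by (auto simp: algebra_simps)
  then show False using not k(1) by (auto simp: in_sector_scale)
qed

lemma sector_monotone:
  assumes "good \<gamma> s t" "(d, e) \<in> turn" "in_sector d e (\<gamma> t - \<gamma> s)" "s \<le> x" "x \<le> y" "y \<le> t"
  shows "in_sector d e (\<gamma> y - \<gamma> x)"
proof -
  have "in_sector d e (\<gamma> y - \<gamma> s)" using sector_from_start[OF assms(1-3), of y] assms by auto
  with sector_from_end[OF good_subinterval[OF assms(1) order_refl assms(6)] assms(2) _, of x]
  show ?thesis using assms by auto
qed

end

section \<open>Minimizing paths in a sector are elbows\<close>

definition moves :: "(real \<Rightarrow> plane) \<Rightarrow> nat \<Rightarrow> real \<Rightarrow> real \<Rightarrow> bool" where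
  "moves \<gamma> d s t \<longleftrightarrow> (\<forall>x y. s \<le> x \<longrightarrow> x < y \<longrightarrow> y \<le> t \<longrightarrow> positive_multiple (\<gamma> y - \<gamma> x) (clock d))"

text \<open>The elbow point with the same coordinate sum as the given point differs from it by a
  multiple of u - w, which is an upward direction for a pair in \<open>turn\<close>.\<close>

lemma elbow_level:
  assumes "\<gamma>x = p + a *\<^sub>R u + b *\<^sub>R w"
  shows "elbow p u w l (a + b) = \<gamma>x + min b (l - a) *\<^sub>R (u - w)"
  by (cases "a + b \<le> l") (auto simp: elbow_def assms min_def max_def algebra_simps)

context cone_decreasing
begin

text \<open>By monotonicity the \<open>F0\<close>-length up to a parameter is the level A + B. At
  equal level the elbow along \<open>clock d\<close>, then \<open>clock e\<close>, lies highest, so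
  f is smallest on it. A minimizing path therefore cannot leave this elbow.\<close>

lemma good_elbow:
  assumes good: "good \<gamma> s t" and st: "s \<le> t" and de: "(d, e) \<in> turn" and sec: "in_sector d e (\<gamma> t - \<gamma> s)"
  obtains \<rho> where "\<rho> \<in> {s..t}" "moves \<gamma> d s \<rho>" "moves \<gamma> e \<rho> t"
proof -
  define u w where "u = clock d" and "w = clock e"
  obtain p q where pq: "\<And>v. v = inner p v *\<^sub>R u + inner q v *\<^sub>R w"
    "\<And>a b. inner p (a *\<^sub>R u + b *\<^sub>R w) = a" "\<And>a b. inner q (a *\<^sub>R u + b *\<^sub>R w) = b"
    using turn_coordinates[OF de] unfolding u_def w_def by metis
  note seci = in_sector_min[OF pq[unfolded u_def w_def]]
  define A B where "A x = inner p (\<gamma> x - \<gamma> s)" and "B x = inner q (\<gamma> x - \<gamma> s)" for x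
  note contg = good_continuous[OF good]
  have cA: "continuous_on {s..t} A" and cB: "continuous_on {s..t} B"
    unfolding A_def B_def by (intro continuous_intros contg)+
  have mono: "A x \<le> A y \<and> B x \<le> B y" if "s \<le> x" "x \<le> y" "y \<le> t" for x y
    using sector_monotone[OF good de sec that]
    by (simp add: seci A_def B_def inner_diff_right)
  have AB0: "A s = 0" "B s = 0" by (auto simp: A_def B_def)
  have g: "\<gamma> x = \<gamma> s + A x *\<^sub>R u + B x *\<^sub>R w" for x
    using pq(1)[of "\<gamma> x - \<gamma> s"] unfolding A_def B_def by (metis add.assoc add.commute diff_add_cancel)
  have inj: "x = y" if "x \<in> {s..t}" "y \<in> {s..t}" "A x = A y" "B x = B y" for x y
    using good_inj[OF good] g[of x] g[of y] that by (auto simp: inj_on_def)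
  define l where "l = A t"
  \<comment> \<open>Given 0 <= B and A <= l, this says that the path stays on the elbow.\<close>
  have dichotomy: "B x = 0 \<or> A x = l" if x0: "x \<in> {s..t}" for x
  proof (rule ccontr)
    assume "\<not> (B x = 0 \<or> A x = l)"
    then have neq: "0 < B x" "A x < l"
      using mono[of s x] mono[of x t] x0 AB0 by (auto simp: l_def)
    define h where "h y = f (elbow (\<gamma> s) u w l y)" for y
    have ch: "continuous_on UNIV h"
      unfolding h_def by (intro continuous_on_compose2[OF cont continuous_elbow]) auto
    obtain H where H: "\<And>y. (H has_real_derivative h y) (at y)"
      using continuous_has_antiderivative[OF ch] by metis
    have cH: "continuous_on UNIV H" using H by (meson DERIV_continuous_on DERIV_subset subset_UNIV)
    define \<Lambda> where "\<Lambda> y = A y + B y" for y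
    have c\<Lambda>: "continuous_on {s..t} \<Lambda>" unfolding \<Lambda>_def by (intro continuous_intros cA cB)
    \<comment> \<open>The excess of f over its value on the elbow at the same level. It is
      nonnegative, and positive at a point off the elbow.\<close>
    define G where "G y = f (\<gamma> y) - h (\<Lambda> y)" for y
    have cG: "continuous_on {s..t} G"
      unfolding G_def by (intro continuous_intros continuous_on_compose2[OF cont contg] continuous_on_compose2[OF ch c\<Lambda>]) auto
    have up: "f (z + r *\<^sub>R (u - w)) < f z" if "0 < r" for z r
    proof -
      obtain k where "k \<in> updirs" "u - w = clock k" using turn_diff_updirs[OF de] by (auto simp: u_def w_def)
      then show ?thesis using decr[of k r 0 z] that eta by simp
    qed
    have hG: "h (\<Lambda> y) = f (\<gamma> y + min (B y) (l - A y) *\<^sub>R (u - w))" for y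
      unfolding h_def \<Lambda>_def elbow_level[OF g] ..
    have G0: "0 \<le> G y" if "y \<in> {s..t}" for y
    proof -
      have "0 \<le> min (B y) (l - A y)" using mono[of s y] mono[of y t] that AB0 by (auto simp: l_def)
      then show ?thesis using up[of "min (B y) (l - A y)" "\<gamma> y"] unfolding G_def hG
        by (metis add.right_neutral diff_ge_0_iff_ge less_eq_real_def scaleR_zero_left)
    qed
    have Gx: "0 < G x" using up[of "min (B x) (l - A x)" "\<gamma> x"] neq unfolding G_def hG by auto
    have xt: "x < t" using x0 neq by (auto simp: l_def intro: le_neq_trans)
    obtain \<delta> where dl: "0 < \<delta>" "\<And>y. y \<in> {s..t} \<Longrightarrow> dist y x < \<delta> \<Longrightarrow> dist (G y) (G x) < G x / 2"
      using cG x0 Gx unfolding continuous_on_iff by (metis half_gt_zero)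
    define z where "z = min t (x + \<delta> / 2)"
    have z: "x < z" "z \<le> t" using xt dl(1) by (auto simp: z_def)
    have Gz: "G x / 2 \<le> G y" if "y \<in> {x..z}" for y
    proof -
      have "dist (G y) (G x) < G x / 2"
        using dl(2)[of y] that x0 z dl(1) by (auto simp: z_def dist_real_def)
      then show ?thesis unfolding dist_real_def by linarith
    qed
    have pws: "piecewise_smooth \<gamma> s t" and len: "finsler_length F \<gamma> s t = finsler_dist F (\<gamma> s) (\<gamma> t)"
      using good_minimizing[OF good st] by (auto simp: minimizing_path_def)
    \<comment> \<open>\<open>G x / 2 \<le> G\<close> on \<open>{x..z}\<close>, so the second summand is length in excess of the elbow.\<close>
    define \<Theta> where "\<Theta> y = H (\<Lambda> y) + G x / 2 * \<Lambda> (max x (min z y))" for y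
    have "\<Theta> t - \<Theta> s \<le> finsler_length F \<gamma> s t"
    proof (rule length_lower_bound[OF pws cont, of "{x, z}"])
      show "continuous_on {s..t} \<Theta>"
        unfolding \<Theta>_def
        by (intro continuous_intros continuous_on_compose2[OF cH c\<Lambda>] continuous_on_compose2[OF c\<Lambda>])
          (use z x0 in auto)
      fix y v assume y: "y \<in> {s<..<t} - {x, z}" and v: "(\<gamma> has_vector_derivative v) (at y)"
      have dA: "(A has_real_derivative inner p v) (at y)" and dB: "(B has_real_derivative inner q v) (at y)"
        unfolding A_def B_def has_real_derivative_iff_has_vector_derivative inner_diff_right
        by (auto intro!: derivative_eq_intros bounded_linear.has_vector_derivative[OF bounded_linear_inner_right v])
      \<comment> \<open>By monotonicity the velocity lies in the sector, where \<open>F0\<close> is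
        the coordinate sum.\<close>
      have nn: "0 \<le> inner p v" "0 \<le> inner q v"
        using mono_on_imp_deriv_nonneg[of "{s..t}" A _ y] mono_on_imp_deriv_nonneg[of "{s..t}" B _ y] dA dB mono y
        by (auto simp: mono_on_def)
      have F0v: "F0 v = inner p v + inner q v"
        using F0_sector[OF de nn] pq(1)[of v] by (simp add: u_def w_def)
      have d\<Lambda>: "(\<Lambda> has_real_derivative F0 v) (at y)"
        unfolding \<Lambda>_def F0v by (intro derivative_intros dA dB)
      define c where "c = (if y \<in> {x<..<z} then F0 v else 0)"
      have dc: "((\<lambda>y. \<Lambda> (max x (min z y))) has_real_derivative c) (at y)"
      proof -
        consider "y < x" | "x < y" "y < z" | "z < y" using y by force
        then show ?thesis
        proof cases
          case 1
          have "((\<lambda>_. \<Lambda> x) has_real_derivative c) (at y)" using 1 by (simp add: c_def)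
          then show ?thesis
            by (rule has_field_derivative_transform_within_open[of _ _ _ "{..<x}"]) (use 1 z in auto)
        next
          case 2
          have "(\<Lambda> has_real_derivative c) (at y)" using 2 d\<Lambda> by (simp add: c_def)
          then show ?thesis
            by (rule has_field_derivative_transform_within_open[of _ _ _ "{x<..<z}"]) (use 2 in auto)
        next
          case 3
          have "((\<lambda>_. \<Lambda> z) has_real_derivative c) (at y)" using 3 by (simp add: c_def)
          then show ?thesis
            by (rule has_field_derivative_transform_within_open[of _ _ _ "{z<..}"]) (use 3 z in auto)
        qed
      qed
      have "(\<Theta> has_real_derivative h (\<Lambda> y) * F0 v + G x / 2 * c) (at y)"
        unfolding \<Theta>_def by (intro DERIV_add DERIV_cmult dc DERIV_chain2[OF H d\<Lambda>])
      moreover have "h (\<Lambda> y) * F0 v + G x / 2 * c \<le> f (\<gamma> y) * F0 v"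
      proof -
        have "G x / 2 * c \<le> G y * F0 v"
          using mult_right_mono[OF Gz F0_nonneg, of y v] mult_nonneg_nonneg[OF G0 F0_nonneg, of y v] y
          by (simp add: c_def)
        then show ?thesis by (simp add: G_def algebra_simps)
      qed
      ultimately show "\<exists>d. (\<Theta> has_real_derivative d) (at y) \<and> d \<le> f (\<gamma> y) * F0 v" by blast
    qed auto
    also have "finsler_length F \<gamma> s t = finsler_dist F (\<gamma> s) (\<gamma> s + l *\<^sub>R u + B t *\<^sub>R w)"
      unfolding len l_def using g[of t] by simp
    also have "\<dots> \<le> integral {0..l + B t} h"
    proof -
      have "F0 u = 1" "F0 w = 1"
        using F0_sector[OF de, of 1 0] F0_sector[OF de, of 0 1] by (auto simp: u_def w_def)
      moreover have "0 \<le> l" "0 \<le> B t" using mono[of s t] st AB0 by (auto simp: l_def)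
      ultimately show ?thesis unfolding h_def by (intro finsler_dist_le_elbow cont pos)
    qed
    also have "\<dots> = H (l + B t) - H 0"
    proof (rule integral_unique, rule fundamental_theorem_of_calculus)
      show "0 \<le> l + B t" using mono[of s t] st AB0 by (auto simp: l_def)
      show "(H has_vector_derivative h x) (at x within {0..l + B t})" for x
        using H[of x] unfolding has_real_derivative_iff_has_vector_derivative by (rule has_vector_derivative_at_within)
    qed
    finally have "\<Theta> t - \<Theta> s \<le> H (l + B t) - H 0" .
    moreover have "\<Theta> t = H (l + B t) + G x / 2 * \<Lambda> z" using z x0 by (simp add: \<Theta>_def \<Lambda>_def l_def)
    moreover have "\<Theta> s = H 0 + G x / 2 * \<Lambda> x" using z x0 by (simp add: \<Theta>_def \<Lambda>_def AB0 max_def)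
    \<comment> \<open>The excess leaves no room for the level to grow between x and z, so both
      coordinates are constant there, against injectivity.\<close>
    ultimately have "G x / 2 * \<Lambda> z \<le> G x / 2 * \<Lambda> x" by linarith
    then have "\<Lambda> z \<le> \<Lambda> x" using Gx by simp
    then have "A x = A z" "B x = B z" using mono[of x z] z x0 by (auto simp: \<Lambda>_def)
    then show False using inj[of x z] z x0 by auto
  qed
  have "closed {y \<in> {s..t}. B y = 0}"
    using continuous_closed_preimage_constant[OF cB closed_atLeastAtMost] .
  then have "compact {y \<in> {s..t}. B y = 0}"
    unfolding compact_eq_bounded_closed by (auto intro: bounded_subset[of "{s..t}"])
  \<comment> \<open>The bend is the last parameter with B = 0. It may be s or t; one edge is then
    empty and \<open>moves\<close> holds vacuously on it.\<close>
  then obtain \<rho> where \<rho>: "\<rho> \<in> {s..t}" "B \<rho> = 0" "\<And>y. y \<in> {s..t} \<Longrightarrow> B y = 0 \<Longrightarrow> y \<le> \<rho>"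
    using compact_attains_sup[of "{y \<in> {s..t}. B y = 0}"] AB0 st by auto
  have late: "A y = l" if "y \<in> {s..t}" "\<rho> < y" for y
    using dichotomy[of y] \<rho>(3)[of y] that by auto
  \<comment> \<open>After the bend A equals l, so a smaller value at the bend would be a jump of the
    continuous function A.\<close>
  have "A \<rho> = l"
  proof (rule ccontr)
    assume "A \<rho> \<noteq> l"
    then have "A \<rho> < l" using mono[of \<rho> t] \<rho>(1) by (auto simp: l_def)
    moreover have "continuous_on {\<rho>..t} A" using cA \<rho>(1) by (auto intro: continuous_on_subset)
    ultimately obtain y where "\<rho> \<le> y" "y \<le> t" "A y = (A \<rho> + l) / 2"
      using IVT'[of A \<rho> "(A \<rho> + l) / 2" t] \<rho>(1) by (auto simp: l_def)
    then show False using late[of y] \<open>A \<rho> < l\<close> \<rho>(1) by (cases "y = \<rho>") auto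
  qed
  show thesis
  proof
    show "\<rho> \<in> {s..t}" by fact
    show "moves \<gamma> d s \<rho>"
      unfolding moves_def positive_multiple_def
    proof (intro allI impI)
      fix x y assume xy: "s \<le> x" "x < y" "y \<le> \<rho>"
      then have "B x = 0" "B y = 0"
        using mono[of s x] mono[of x \<rho>] mono[of s y] mono[of y \<rho>] \<rho> AB0 by auto
      moreover from this have "A x < A y" using mono[of x y] inj[of x y] xy \<rho>(1) by force
      ultimately show "\<exists>r>0. \<gamma> y - \<gamma> x = r *\<^sub>R clock d"
        using g[of x] g[of y] by (intro exI[of _ "A y - A x"]) (simp add: u_def algebra_simps)
    qed
    show "moves \<gamma> e \<rho> t"
      unfolding moves_def positive_multiple_def
    proof (intro allI impI)
      fix x y assume xy: "\<rho> \<le> x" "x < y" "y \<le> t"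
      then have "A x = l" "A y = l"
        using late[of x] late[of y] \<open>A \<rho> = l\<close> \<rho>(1) by (cases "x = \<rho>"; auto)+
      moreover from this have "B x < B y" using mono[of x y] inj[of x y] xy \<rho>(1) by force
      ultimately show "\<exists>r>0. \<gamma> y - \<gamma> x = r *\<^sub>R clock e"
        using g[of x] g[of y] by (intro exI[of _ "B y - B x"]) (simp add: w_def algebra_simps)
    qed
  qed
qed

lemma good_moves:
  assumes "good \<gamma> s t" "s \<le> t"
  obtains d e \<rho> where "(d, e) \<in> turn" "\<rho> \<in> {s..t}" "moves \<gamma> d s \<rho>" "moves \<gamma> e \<rho> t"
proof -
  obtain d e a b where de: "(d, e) \<in> turn" and v: "0 \<le> a" "0 \<le> b" "\<gamma> t - \<gamma> s = a *\<^sub>R clock d + b *\<^sub>R clock e"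
    by (rule sector_cover)
  then have "in_sector d e (\<gamma> t - \<gamma> s)" unfolding in_sector_def by blast
  from good_elbow[OF assms de this] that[OF de] show thesis by metis
qed

text \<open>Continuity of \<gamma> is only available on closed intervals between nearby parameters,
  where the path minimizes. The two sides of t are therefore treated separately, which also covers t
  at an end of I.\<close>

lemma geodesic_locally_good:
  assumes geo: "finsler_geodesic F \<gamma> I" and t: "t \<in> I"
  obtains \<delta> where "0 < \<delta>" "\<And>x y. \<lbrakk>x \<in> I; y \<in> I; t - \<delta> < x; y < t + \<delta>\<rbrakk> \<Longrightarrow> good \<gamma> x y"
proof -
  have int: "z \<in> I" if "x \<in> I" "y \<in> I" "x \<le> z" "z \<le> y" for x y z
    using geo that unfolding finsler_geodesic_def is_interval_1 by blast
  obtain J where J: "openin (top_of_set I) J" "t \<in> J"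
      "\<And>t1 t2. t1 \<in> J \<Longrightarrow> t2 \<in> J \<Longrightarrow> t1 \<le> t2 \<Longrightarrow> minimizing_path F \<gamma> t1 t2"
    using geo t unfolding finsler_geodesic_def locally_minimizing_def by blast
  obtain \<delta>1 where d1: "0 < \<delta>1" "\<And>x. x \<in> I \<Longrightarrow> dist x t < \<delta>1 \<Longrightarrow> x \<in> J"
    using J(1,2) unfolding openin_euclidean_subtopology_iff by blast
  have cont_near: "continuous_on {x..y} (\<lambda>z. f (\<gamma> z))"
    if "x \<in> I" "y \<in> I" "dist x t < \<delta>1" "dist y t < \<delta>1" for x y
  proof (cases "x \<le> y")
    case True
    then have "continuous_on {x..y} \<gamma>"
      using J(3)[OF d1(2) d1(2)] that piecewise_smooth_continuous unfolding minimizing_path_def by blast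
    then show ?thesis by (intro continuous_on_compose2[OF cont]) auto
  qed simp
  \<comment> \<open>Places f at \<gamma> t strictly between m and m * (1 + slack).\<close>
  define m where "m = f (\<gamma> t) / (1 + slack / 2)"
  have m: "0 < m" "m < f (\<gamma> t)" "f (\<gamma> t) < m * (1 + slack)"
    using pos[of "\<gamma> t"] slack_pos by (auto simp: m_def field_simps)
  define P where "P z \<longleftrightarrow> m \<le> f (\<gamma> z) \<and> f (\<gamma> z) \<le> m * (1 + slack)" for z
  define \<epsilon> where "\<epsilon> = min (f (\<gamma> t) - m) (m * (1 + slack) - f (\<gamma> t))"
  have eps: "0 < \<epsilon>" using m by (simp add: \<epsilon>_def)
  have Peps: "P z" if "dist (f (\<gamma> z)) (f (\<gamma> t)) < \<epsilon>" for z
    using that by (auto simp: P_def \<epsilon>_def dist_real_def abs_if split: if_splits)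
  have Pt: "P t" using m by (simp add: P_def)
  have near: "\<exists>\<delta>>0. \<forall>z\<in>{min t y..max t y}. dist z t < \<delta> \<longrightarrow> P z" if "y \<in> I" "dist y t < \<delta>1" for y
  proof -
    have "continuous_on {min t y..max t y} (\<lambda>z. f (\<gamma> z))"
      using cont_near[of t y] cont_near[of y t] that t d1(1) by (auto simp: min_def max_def)
    moreover have "t \<in> {min t y..max t y}" by auto
    ultimately show ?thesis using eps Peps unfolding continuous_on_iff by meson
  qed
  have right: "\<exists>\<delta>>0. \<forall>z\<in>I. t \<le> z \<longrightarrow> z < t + \<delta> \<longrightarrow> P z"
  proof (cases "\<exists>y\<in>I. t < y \<and> dist y t < \<delta>1")
    case True
    then obtain y \<delta> where y: "y \<in> I" "t < y" "dist y t < \<delta>1" and d: "0 < \<delta>"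
      "\<forall>z\<in>{min t y..max t y}. dist z t < \<delta> \<longrightarrow> P z"
      using near by blast
    then show ?thesis by (intro exI[of _ "min \<delta> (y - t)"]) (auto simp: dist_real_def)
  next
    case False
    \<comment> \<open>On this side t is the only parameter of I within the distance
      \<delta>1.\<close>
    then have "P z" if "z \<in> I" "t \<le> z" "z < t + \<delta>1" for z
      using that Pt by (cases "z = t") (force simp: dist_real_def)+
    then show ?thesis using d1(1) by blast
  qed
  have left: "\<exists>\<delta>>0. \<forall>z\<in>I. z \<le> t \<longrightarrow> t - \<delta> < z \<longrightarrow> P z"
  proof (cases "\<exists>y\<in>I. y < t \<and> dist y t < \<delta>1")
    case True
    then obtain y \<delta> where y: "y \<in> I" "y < t" "dist y t < \<delta>1" and d: "0 < \<delta>"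
      "\<forall>z\<in>{min t y..max t y}. dist z t < \<delta> \<longrightarrow> P z"
      using near by blast
    then show ?thesis by (intro exI[of _ "min \<delta> (t - y)"]) (auto simp: dist_real_def)
  next
    case False
    then have "P z" if "z \<in> I" "z \<le> t" "t - \<delta>1 < z" for z
      using that Pt by (cases "z = t") (force simp: dist_real_def)+
    then show ?thesis using d1(1) by blast
  qed
  obtain \<delta>r \<delta>l where dr: "0 < \<delta>r" "\<And>z. z \<in> I \<Longrightarrow> t \<le> z \<Longrightarrow> z < t + \<delta>r \<Longrightarrow> P z"
    and dl: "0 < \<delta>l" "\<And>z. z \<in> I \<Longrightarrow> z \<le> t \<Longrightarrow> t - \<delta>l < z \<Longrightarrow> P z"
    using left right by blast
  show thesis
  proof (rule that[of "min \<delta>1 (min \<delta>r \<delta>l)"])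
    show "0 < min \<delta>1 (min \<delta>r \<delta>l)" using d1 dr dl by simp
    fix x y assume xy: "x \<in> I" "y \<in> I" "t - min \<delta>1 (min \<delta>r \<delta>l) < x" "y < t + min \<delta>1 (min \<delta>r \<delta>l)"
    show "good \<gamma> x y"
      unfolding good_def
    proof (intro conjI allI impI)
      fix x' y' assume "x \<le> x'" "x' \<le> y'" "y' \<le> y"
      then show "minimizing_path F \<gamma> x' y'"
        using xy int[OF xy(1,2), of x'] int[OF xy(1,2), of y']
        by (intro J(3) d1(2)) (auto simp: dist_real_def)
    next
      have "{x..y} \<subseteq> I" using int[OF xy(1,2)] by auto
      then show "pauses_nowhere \<gamma> {x..y}"
        using geo unfolding finsler_geodesic_def pauses_nowhere_def by blast
      have "P z" if "z \<in> {x..y}" for z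
        using that dr(2)[of z] dl(2)[of z] int[OF xy(1,2), of z] xy by (cases "t \<le> z") auto
      then show "\<exists>m>0. \<forall>x\<in>{x..y}. m \<le> f (\<gamma> x) \<and> f (\<gamma> x) \<le> m * (1 + slack)"
        using m(1) unfolding P_def by blast
    qed
  qed
qed

end

section \<open>Polygonal structure of geodesics\<close>

lemma moves_mono: "moves \<gamma> d s t \<Longrightarrow> s \<le> s' \<Longrightarrow> t' \<le> t \<Longrightarrow> moves \<gamma> d s' t'"
  unfolding moves_def by (meson order_trans)

lemma positive_multiple_add:
  assumes "positive_multiple v u" "positive_multiple w u" shows "positive_multiple (v + w) u"
  using assms unfolding positive_multiple_def by (metis add_pos_pos scaleR_add_left)

lemma moves_join:
  assumes "moves \<gamma> d s r" "moves \<gamma> d r t"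
  shows "moves \<gamma> d s t"
  unfolding moves_def
proof (intro allI impI)
  fix x y assume xy: "s \<le> x" "x < y" "y \<le> t"
  consider "y \<le> r" | "r \<le> x" | "x < r" "r < y" by linarith
  then show "positive_multiple (\<gamma> y - \<gamma> x) (clock d)"
  proof cases
    case 3
    then have "positive_multiple (\<gamma> y - \<gamma> r) (clock d)" "positive_multiple (\<gamma> r - \<gamma> x) (clock d)"
      using assms xy by (auto simp: moves_def)
    from positive_multiple_add[OF this] show ?thesis by simp
  qed (use assms xy in \<open>auto simp: moves_def\<close>)
qed

lemma dirs_norm: "d \<in> dirs \<Longrightarrow> norm (clock d) = 1"
  by (auto simp: dirs_def clock_values norm_prod_def power_divide)

lemma moves_unique:
  assumes "moves \<gamma> d s t" "moves \<gamma> e s t" "s < t" "d \<in> dirs" "e \<in> dirs"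
  shows "d = e"
proof -
  obtain a b where ab: "0 < a" "\<gamma> t - \<gamma> s = a *\<^sub>R clock d" "0 < b" "\<gamma> t - \<gamma> s = b *\<^sub>R clock e"
    using assms(1-3) unfolding moves_def positive_multiple_def by (metis order_refl)
  then have "norm (a *\<^sub>R clock d) = norm (b *\<^sub>R clock e)" by metis
  then have "a = b" using ab dirs_norm assms by simp
  then have "clock d = clock e" using ab by simp
  then show ?thesis using assms(4,5) by (auto simp: dirs_def clock_values)
qed

text \<open>The strict inequality gives every edge positive duration and hence positive
  length.\<close>

fun chain :: "(real \<Rightarrow> plane) \<Rightarrow> nat list \<Rightarrow> real \<Rightarrow> real \<Rightarrow> bool" where
  "chain \<gamma> [] s t \<longleftrightarrow> s = t"
| "chain \<gamma> (d # ds) s t \<longleftrightarrow> (\<exists>r. s < r \<and> r \<le> t \<and> moves \<gamma> d s r \<and> chain \<gamma> ds r t)"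

definition reduced :: "nat list \<Rightarrow> bool" where
  "reduced ds \<longleftrightarrow> ds \<noteq> [] \<and> set ds \<subseteq> dirs \<and> successively (\<lambda>d e. (d, e) \<in> turn) ds"

lemma chain_le: "chain \<gamma> ds s t \<Longrightarrow> s \<le> t"
  by (cases ds) auto

text \<open>Edges with the same direction on both sides of r merge, which drops the head of
  \<open>es\<close>. The junction hypothesis speaks of all x between s and r, so it survives the
  removal of first edges in the induction.\<close>

lemma chain_join:
  assumes "chain \<gamma> ds s r" "ds \<noteq> []" "chain \<gamma> es r t" "es \<noteq> []" "set ds \<subseteq> dirs" "set es \<subseteq> dirs"
    and "\<And>d e x y. \<lbrakk>s \<le> x; x < r; r < y; y \<le> t; d \<in> dirs; e \<in> dirs; moves \<gamma> d x r; moves \<gamma> e r y\<rbrakk> \<Longrightarrow>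
      d = e \<or> (d, e) \<in> turn"
  shows "last ds = hd es \<and> chain \<gamma> (ds @ tl es) s t \<or> (last ds, hd es) \<in> turn \<and> chain \<gamma> (ds @ es) s t"
  using assms
proof (induction ds arbitrary: s)
  case (Cons d ds)
  obtain r' where r': "s < r'" "r' \<le> r" "moves \<gamma> d s r'" "chain \<gamma> ds r' r"
    using Cons.prems(1) by auto
  show ?case
  proof (cases "ds = []")
    case True
    obtain e es' where es: "es = e # es'" using Cons.prems(4) by (cases es) auto
    obtain q where q: "r < q" "q \<le> t" "moves \<gamma> e r q" "chain \<gamma> es' q t"
      using Cons.prems(3) es by auto
    have r: "r' = r" using r' True by simp
    have "d = e \<or> (d, e) \<in> turn"
      using Cons.prems(7)[of s q d e] r' q r Cons.prems(5,6) es by auto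
    then show ?thesis
    proof
      assume "d = e"
      then have "moves \<gamma> d s q" using moves_join r'(3) q(3) r by blast
      then show ?thesis using \<open>d = e\<close> True es r' q by auto
    next
      assume "(d, e) \<in> turn"
      then show ?thesis using True es r' q r by auto
    qed
  next
    case False
    have "last ds = hd es \<and> chain \<gamma> (ds @ tl es) r' t \<or> (last ds, hd es) \<in> turn \<and> chain \<gamma> (ds @ es) r' t"
      by (rule Cons.IH[OF r'(4) False Cons.prems(3,4) _ Cons.prems(6) Cons.prems(7)]) (use Cons.prems(5) r' in auto)
    moreover have "r' \<le> t" using chain_le[OF Cons.prems(3)] r'(2) by simp
    ultimately show ?thesis using r' False by auto
  qed
qed simp

lemma reduced_append:
  assumes "reduced ds" "reduced es" "(last ds, hd es) \<in> turn"
  shows "reduced (ds @ es)"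
  using assms by (auto simp: reduced_def successively_append_iff)

lemma reduced_append_tl:
  assumes "reduced ds" "reduced es" "last ds = hd es"
  shows "reduced (ds @ tl es)"
  using assms by (cases es; cases "tl es") (auto simp: reduced_def successively_append_iff successively_Cons)

lemma sublist_four: "sublist (x # xs) [a, b, c, d] \<longleftrightarrow>
    x = a \<and> prefix xs [b, c, d] \<or> x = b \<and> prefix xs [c, d] \<or> x = c \<and> prefix xs [d] \<or> x = d \<and> xs = []"
  by (simp only: sublist_code(2,3) Cons_prefix_Cons prefix_Nil simp_thms)

text \<open>As a directed graph, \<open>turn\<close> consists of two paths from 0 to 6, so a walk in
  it is a contiguous part of one of them.\<close>

lemma reduced_sublist:
  assumes "reduced ds"
  shows "sublist ds [0, 2, 4, 6] \<or> sublist ds [0, 10, 8, 6]"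
proof -
  have "ds \<noteq> [] \<Longrightarrow> set ds \<subseteq> dirs \<Longrightarrow> successively (\<lambda>d e. (d, e) \<in> turn) ds \<Longrightarrow> ?thesis"
  proof (induction ds)
    case (Cons d ds)
    show ?case
    proof (cases ds)
      case Nil
      have "d = 0 \<or> d = 2 \<or> d = 4 \<or> d = 6 \<or> d = 8 \<or> d = 10"
        using Cons.prems(2) by (simp add: dirs_def)
      then show ?thesis unfolding Nil sublist_four by (elim disjE) simp_all
    next
      case (Cons e es)
      then have IH: "sublist (e # es) [0, 2, 4, 6] \<or> sublist (e # es) [0, 10, 8, 6]"
        using Cons.IH Cons.prems by simp
      have "d = 0 \<and> e = 2 \<or> d = 2 \<and> e = 4 \<or> d = 4 \<and> e = 6 \<or> d = 0 \<and> e = 10 \<or> d = 10 \<and> e = 8 \<or> d = 8 \<and> e = 6"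
        using Cons Cons.prems(3) by (simp add: turn_def)
      then show ?thesis using IH unfolding Cons sublist_four Cons_prefix_Cons by (elim disjE conjE) simp_all
    qed
  qed simp
  then show ?thesis using assms by (simp add: reduced_def)
qed

context cone_decreasing
begin

text \<open>Near r the geodesic is an elbow. Its bend lies before, at or after r, and since
  directions are determined on nontrivial intervals, d and e are read off from its edges.\<close>

lemma geodesic_junction:
  assumes geo: "finsler_geodesic F \<gamma> I" and xy: "x \<in> I" "y \<in> I" "x < r" "r < y"
    and de: "d \<in> dirs" "e \<in> dirs" "moves \<gamma> d x r" "moves \<gamma> e r y"
  shows "d = e \<or> (d, e) \<in> turn"
proof -
  have int: "z \<in> I" if "x \<le> z" "z \<le> y" for z
    using geo xy that unfolding finsler_geodesic_def is_interval_1 by blast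
  obtain \<delta> where d: "0 < \<delta>" "\<And>x y. \<lbrakk>x \<in> I; y \<in> I; r - \<delta> < x; y < r + \<delta>\<rbrakk> \<Longrightarrow> good \<gamma> x y"
    using geodesic_locally_good[OF geo, of r] int xy by (metis less_imp_le)
  define x' y' where "x' = max x (r - \<delta> / 2)" and "y' = min y (r + \<delta> / 2)"
  have x': "x \<le> x'" "x' < r" "r < y'" "y' \<le> y" "r - \<delta> < x'" "y' < r + \<delta>"
    using d(1) xy by (auto simp: x'_def y'_def)
  have "good \<gamma> x' y'" using d(2) x' int by auto
  then obtain d0 e0 \<rho> where t: "(d0, e0) \<in> turn" "\<rho> \<in> {x'..y'}" "moves \<gamma> d0 x' \<rho>" "moves \<gamma> e0 \<rho> y'"
    using good_moves x' by (metis less_imp_le order_trans)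
  note dd = turn_dirs[OF t(1)]
  have u: "d = k" if "moves \<gamma> k a r" "x' \<le> a" "a < r" "k \<in> dirs" for k a
    using moves_unique[of \<gamma> d a r k] moves_mono[OF de(3), of a r] that x' de by auto
  have v: "e = k" if "moves \<gamma> k r b" "r < b" "b \<le> y'" "k \<in> dirs" for k b
    using moves_unique[of \<gamma> e r b k] moves_mono[OF de(4), of r b] that x' de by auto
  consider "\<rho> < r" | "\<rho> = r" | "r < \<rho>" by linarith
  then show ?thesis
  proof cases
    case 1
    then have "d = e0" "e = e0"
      using u[of e0 \<rho>] v[of e0 y'] moves_mono[OF t(4), of \<rho> r] moves_mono[OF t(4), of r y'] t(2) dd x' by auto
    then show ?thesis by simp
  next
    case 2
    then have "d = d0" "e = e0" using u[of d0 x'] v[of e0 y'] t dd x' by auto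
    then show ?thesis using t(1) by simp
  next
    case 3
    then have "d = d0" "e = d0"
      using u[of d0 x'] v[of d0 \<rho>] moves_mono[OF t(3), of x' r] moves_mono[OF t(3), of r \<rho>] t(2) dd x' by auto
    then show ?thesis by simp
  qed
qed

lemma geodesic_chain_join:
  assumes "finsler_geodesic F \<gamma> I" "s \<in> I" "t \<in> I"
    and "reduced ds" "chain \<gamma> ds s r" "reduced es" "chain \<gamma> es r t"
  shows "last ds = hd es \<and> reduced (ds @ tl es) \<and> chain \<gamma> (ds @ tl es) s t \<or>
    reduced (ds @ es) \<and> chain \<gamma> (ds @ es) s t"
proof -
  have int: "z \<in> I" if "s \<le> z" "z \<le> t" for z
    using assms(1-3) that unfolding finsler_geodesic_def is_interval_1 by blast
  have "last ds = hd es \<and> chain \<gamma> (ds @ tl es) s t \<or> (last ds, hd es) \<in> turn \<and> chain \<gamma> (ds @ es) s t"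
    by (rule chain_join[OF assms(5) _ assms(7)])
      (use assms(4,6) geodesic_junction[OF assms(1) int int] chain_le[OF assms(5)] chain_le[OF assms(7)]
        in \<open>auto simp: reduced_def\<close>)
  then show ?thesis using reduced_append reduced_append_tl assms(4,6) by blast
qed

text \<open>Bisection: short intervals carry an elbow by \<open>good_moves\<close>, and adjacent
  chains join by \<open>geodesic_chain_join\<close>.\<close>

lemma geodesic_chain:
  assumes geo: "finsler_geodesic F \<gamma> I" and st: "s \<in> I" "t \<in> I" "s < t"
  obtains ds where "reduced ds" "chain \<gamma> ds s t"
proof -
  have int: "z \<in> I" if "s \<le> z" "z \<le> t" for z
    using geo st that unfolding finsler_geodesic_def is_interval_1 by blast
  \<comment> \<open>The bisection rule speaks of arbitrary intervals, so containment in the given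
    one is part of the predicate.\<close>
  have "s \<le> s \<longrightarrow> t \<le> t \<longrightarrow> s < t \<longrightarrow> (\<exists>ds. reduced ds \<and> chain \<gamma> ds s t)"
  proof (rule Bolzano[of s t "\<lambda>a b. s \<le> a \<longrightarrow> b \<le> t \<longrightarrow> a < b \<longrightarrow> (\<exists>ds. reduced ds \<and> chain \<gamma> ds a b)"])
    show "s \<le> t" using st by simp
  next
    fix a b c
    assume H: "s \<le> a \<longrightarrow> b \<le> t \<longrightarrow> a < b \<longrightarrow> (\<exists>ds. reduced ds \<and> chain \<gamma> ds a b)"
      "s \<le> b \<longrightarrow> c \<le> t \<longrightarrow> b < c \<longrightarrow> (\<exists>ds. reduced ds \<and> chain \<gamma> ds b c)" "a \<le> b" "b \<le> c"
    show "s \<le> a \<longrightarrow> c \<le> t \<longrightarrow> a < c \<longrightarrow> (\<exists>ds. reduced ds \<and> chain \<gamma> ds a c)"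
    proof (intro impI)
      assume ac: "s \<le> a" "c \<le> t" "a < c"
      show "\<exists>ds. reduced ds \<and> chain \<gamma> ds a c"
      proof (cases "a = b \<or> b = c")
        case True then show ?thesis using H ac by auto
      next
        case False
        then obtain ds es where "reduced ds" "chain \<gamma> ds a b" "reduced es" "chain \<gamma> es b c"
          using H ac by force
        from geodesic_chain_join[OF geo _ _ this] show ?thesis using int ac H by auto
      qed
    qed
  next
    fix x assume "s \<le> x" "x \<le> t"
    then obtain \<delta> where d: "0 < \<delta>" "\<And>a b. \<lbrakk>a \<in> I; b \<in> I; x - \<delta> < a; b < x + \<delta>\<rbrakk> \<Longrightarrow> good \<gamma> a b"
      using geodesic_locally_good[OF geo int] by metis
    have "\<exists>ds. reduced ds \<and> chain \<gamma> ds a b"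
      if ab: "a \<le> x" "x \<le> b" "b - a < \<delta>" "s \<le> a" "b \<le> t" "a < b" for a b
    proof -
      have "good \<gamma> a b" using d(2)[of a b] int ab by auto
      then obtain d e \<rho> where t: "(d, e) \<in> turn" "\<rho> \<in> {a..b}" "moves \<gamma> d a \<rho>" "moves \<gamma> e \<rho> b"
        using good_moves ab(6) by (metis less_imp_le)
      have red: "reduced [d]" "reduced [e]" "reduced [d, e]"
        using t(1) turn_dirs[OF t(1)] by (auto simp: reduced_def)
      \<comment> \<open>An elbow with an empty edge yields a chain with one direction.\<close>
      consider "\<rho> = a" | "\<rho> = b" | "a < \<rho>" "\<rho> < b" using t(2) by force
      then show ?thesis
      proof cases
        case 1 then show ?thesis using red t ab(6) by (intro exI[of _ "[e]"]) auto
      next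
        case 2 then show ?thesis using red t ab(6) by (intro exI[of _ "[d]"]) auto
      next
        case 3 then show ?thesis using red t by (intro exI[of _ "[d, e]"]) auto
      qed
    qed
    then show "\<exists>d>0. \<forall>a b. a \<le> x \<and> x \<le> b \<and> b - a < d \<longrightarrow>
        s \<le> a \<longrightarrow> b \<le> t \<longrightarrow> a < b \<longrightarrow> (\<exists>ds. reduced ds \<and> chain \<gamma> ds a b)"
      using d(1) by blast
  qed
  then show thesis using st that by blast
qed

end

section \<open>Polygonal lines as point sets\<close>

fun trace :: "plane \<Rightarrow> (real \<times> nat) list \<Rightarrow> plane set" where
  "trace p [] = {p}"
| "trace p ((l, d) # ls) = closed_segment p (p + l *\<^sub>R clock d) \<union> trace (p + l *\<^sub>R clock d) ls"

definition displacement :: "(real \<times> nat) list \<Rightarrow> plane" where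
  "displacement ls = (\<Sum>(l, d)\<leftarrow>ls. l *\<^sub>R clock d)"

abbreviation positive_lengths :: "(real \<times> nat) list \<Rightarrow> bool" where
  "positive_lengths ls \<equiv> \<forall>l\<in>fst ` set ls. 0 < l"

lemma displacement_simps [simp]:
  "displacement [] = 0" "displacement ((l, d) # ls) = l *\<^sub>R clock d + displacement ls"
  "displacement (ls @ ls') = displacement ls + displacement ls'"
  by (simp_all add: displacement_def)

lemma start_in_trace: "p \<in> trace p ls"
  by (cases ls) auto

lemma trace_append: "trace p (ls @ ls') = trace p ls \<union> trace (p + displacement ls) ls'"
proof (induction ls arbitrary: p)
  case Nil
  then show ?case using start_in_trace[of p ls'] by auto
next
  case (Cons a ls)
  then show ?case by (cases a) (auto simp: add.assoc)
qed

lemma segment_along: "0 \<le> l \<Longrightarrow> closed_segment p (p + l *\<^sub>R v) = {p + a *\<^sub>R v |a. 0 \<le> a \<and> a \<le> l}"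
  for p v :: "'a::real_vector"
proof (intro equalityI subsetI)
  fix x assume l: "0 \<le> l" and "x \<in> closed_segment p (p + l *\<^sub>R v)"
  then obtain u where "0 \<le> u" "u \<le> 1" "x = p + (u * l) *\<^sub>R v"
    by (auto simp: closed_segment_def algebra_simps)
  then show "x \<in> {p + a *\<^sub>R v |a. 0 \<le> a \<and> a \<le> l}"
    using l by (auto intro!: exI[of _ "u * l"] mult_left_le_one_le)
next
  fix x assume l: "0 \<le> l" and "x \<in> {p + a *\<^sub>R v |a. 0 \<le> a \<and> a \<le> l}"
  then obtain a where a: "0 \<le> a" "a \<le> l" "x = p + a *\<^sub>R v" by auto
  show "x \<in> closed_segment p (p + l *\<^sub>R v)"
  proof (cases "l = 0")
    case False
    then show ?thesis
      using a l unfolding closed_segment_def by (auto intro!: exI[of _ "a / l"] simp: algebra_simps)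
  qed (use a in auto)
qed

lemma chain_trace:
  assumes "chain \<gamma> ds s t"
  shows "\<exists>ls. map snd ls = ds \<and> positive_lengths ls \<and> \<gamma> ` {s..t} \<subseteq> trace (\<gamma> s) ls \<and> \<gamma> t = \<gamma> s + displacement ls"
  using assms
proof (induction ds arbitrary: s)
  case Nil
  then show ?case by (intro exI[of _ "[]"]) auto
next
  case (Cons d ds)
  then obtain r where r: "s < r" "r \<le> t" "moves \<gamma> d s r" "chain \<gamma> ds r t" by auto
  from Cons.IH[OF r(4)] obtain ls where
    ls: "map snd ls = ds" "positive_lengths ls" "\<gamma> ` {r..t} \<subseteq> trace (\<gamma> r) ls" "\<gamma> t = \<gamma> r + displacement ls" by blast
  obtain l where l: "0 < l" "\<gamma> r = \<gamma> s + l *\<^sub>R clock d"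
    using r(1,3) unfolding moves_def positive_multiple_def by (metis add.commute diff_add_cancel order_refl)
  have "\<gamma> x \<in> closed_segment (\<gamma> s) (\<gamma> s + l *\<^sub>R clock d)" if x: "x \<in> {s..r}" for x
  proof -
    consider "x = s" | "x = r" | "s < x" "x < r" using x by force
    then show ?thesis
    proof cases
      case 3
      then obtain a b where ab: "0 < a" "\<gamma> x - \<gamma> s = a *\<^sub>R clock d" "0 < b" "\<gamma> r - \<gamma> x = b *\<^sub>R clock d"
        using r(3) unfolding moves_def positive_multiple_def by (metis less_imp_le order_refl)
      then have eq: "\<gamma> s + l *\<^sub>R clock d = \<gamma> s + (a + b) *\<^sub>R clock d" "\<gamma> x = \<gamma> s + a *\<^sub>R clock d"
        using l(2) by (simp_all add: algebra_simps)
      have nn: "0 \<le> a + b" using ab by simp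
      show ?thesis unfolding eq segment_along[OF nn] using ab(1,3) by (intro CollectI exI[of _ a]) auto
    qed (use l in auto)
  qed
  moreover have "{s..t} = {s..r} \<union> {r..t}" using r by auto
  ultimately have "\<gamma> ` {s..t} \<subseteq> trace (\<gamma> s) ((l, d) # ls)"
    using ls(3) l(2) by auto
  then show ?case using ls l by (intro exI[of _ "(l, d) # ls"]) auto
qed

lemma displacement_sign:
  assumes "\<forall>(l, d)\<in>set ls. 0 < l \<and> 0 \<le> \<sigma> * fst (clock d)"
  shows "0 \<le> \<sigma> * fst (displacement ls) \<and>
    ((\<exists>d\<in>snd ` set ls. 0 < \<sigma> * fst (clock d)) \<longrightarrow> 0 < \<sigma> * fst (displacement ls))"
  using assms
proof (induction ls)
  case (Cons a ls)
  obtain l d where a: "a = (l, d)" by fastforce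
  have l: "0 < l" "0 \<le> \<sigma> * fst (clock d)" using Cons.prems a by auto
  then have "0 \<le> l * (\<sigma> * fst (clock d))" by simp
  moreover have "0 < l * (\<sigma> * fst (clock d))" if "0 < \<sigma> * fst (clock d)" using l that by simp
  ultimately show ?case using Cons by (auto simp: a algebra_simps add_pos_nonneg add_nonneg_pos)
qed simp

text \<open>Of two consecutive edges one is not vertical, and by \<open>reduced_sublist\<close> all
  edges lean to the same side. So the horizontal displacement does not vanish unless there is a
  single edge, whose length is positive.\<close>

lemma reduced_displacement_nonzero:
  assumes "reduced (map snd ls)" "positive_lengths ls"
  shows "displacement ls \<noteq> 0"
proof (cases "\<exists>l d. ls = [(l, d)]")
  case True
  then obtain l d where ls: "ls = [(l, d)]" by blast
  then have "norm (displacement ls) = l"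
    using assms dirs_norm[of d] by (auto simp: reduced_def)
  then show ?thesis using assms ls by auto
next
  case False
  let ?ds = "map snd ls"
  obtain d e es where ds: "?ds = d # e # es"
    using False assms(1) by (cases ls; cases "tl ls") (auto simp: reduced_def)
  then have "(d, e) \<in> turn" using assms(1) by (simp add: reduced_def)
  then have lateral: "d \<in> {2, 4, 8, 10} \<or> e \<in> {2, 4, 8, 10}" by (auto simp: turn_def)
  have "\<exists>\<sigma>::real. (\<forall>d\<in>set ?ds. 0 \<le> \<sigma> * fst (clock d)) \<and> (\<exists>d\<in>set ?ds. 0 < \<sigma> * fst (clock d))"
    using reduced_sublist[OF assms(1)]
  proof
    assume "sublist ?ds [0, 2, 4, 6]"
    then have "set ?ds \<subseteq> {0, 2, 4, 6}" using set_mono_sublist by fastforce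
    then show ?thesis using lateral unfolding ds by (intro exI[of _ 1]) (auto simp: clock_values)
  next
    assume "sublist ?ds [0, 10, 8, 6]"
    then have "set ?ds \<subseteq> {0, 10, 8, 6}" using set_mono_sublist by fastforce
    then show ?thesis using lateral unfolding ds by (intro exI[of _ "-1"]) (auto simp: clock_values)
  qed
  then obtain \<sigma> :: real where "\<forall>d\<in>snd ` set ls. 0 \<le> \<sigma> * fst (clock d)" "\<exists>d\<in>snd ` set ls. 0 < \<sigma> * fst (clock d)"
    by auto
  then have "0 < \<sigma> * fst (displacement ls)"
    using displacement_sign[of ls \<sigma>] assms(2) by force
  then show ?thesis by auto
qed

text \<open>The first edge is lengthened backwards and then the last edge of the result forwards.
  Proceeding in this order also covers a single edge, which is lengthened at both ends.\<close>

lemma trace_extend: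
  assumes "ls \<noteq> []" "positive_lengths ls" "0 < M"
  obtains p' ls' where "map snd ls' = map snd ls" "positive_lengths ls'" "trace p ls \<subseteq> trace p' ls'"
    "\<And>a. 0 \<le> a \<Longrightarrow> a \<le> M \<Longrightarrow> p - a *\<^sub>R clock (snd (hd ls)) \<in> trace p' ls'"
    "\<And>a. 0 \<le> a \<Longrightarrow> a \<le> M \<Longrightarrow> p + displacement ls + a *\<^sub>R clock (snd (last ls)) \<in> trace p' ls'"
proof -
  obtain l d r where ls: "ls = (l, d) # r" using assms(1) by (cases ls) auto
  have l: "0 < l" using assms(2) ls by simp
  define p' ls1 where "p' = p - M *\<^sub>R clock d" and "ls1 = (l + M, d) # r"
  have fin: "p' + (l + M) *\<^sub>R clock d = p + l *\<^sub>R clock d" by (simp add: p'_def algebra_simps)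
  have ls1: "map snd ls1 = map snd ls" "positive_lengths ls1" "p' + displacement ls1 = p + displacement ls"
    using assms(2,3) by (auto simp: ls ls1_def p'_def algebra_simps)
  have bwd: "p + a *\<^sub>R clock d \<in> trace p' ls1" if "- M \<le> a" "a \<le> l" for a
  proof -
    have "p + a *\<^sub>R clock d = p' + (a + M) *\<^sub>R clock d" by (simp add: p'_def algebra_simps)
    then show ?thesis using that l assms(3) by (auto simp: ls1_def segment_along)
  qed
  have sub1: "trace p ls \<subseteq> trace p' ls1"
    using bwd l assms(3) by (auto simp: ls segment_along) (auto simp: ls1_def fin)
  have "ls1 \<noteq> []" by (simp add: ls1_def)
  then obtain r' k e where r': "ls1 = r' @ [(k, e)]" by (metis append_butlast_last_id surj_pair)
  have k: "0 < k" using ls1(2) r' by simp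
  define ls' where "ls' = r' @ [(k + M, e)]"
  have e: "e = snd (last ls)"
    using ls1(1) r' assms(1) by (metis last_map last_snoc map_is_Nil_conv snd_conv)
  have fwd: "p' + displacement r' + a *\<^sub>R clock e \<in> trace p' ls'" if "0 \<le> a" "a \<le> k + M" for a
    using that k assms(3) by (auto simp: ls'_def trace_append segment_along)
  have sub2: "trace p' ls1 \<subseteq> trace p' ls'"
    using fwd k assms(3) by (auto simp: r' trace_append segment_along) (auto simp: ls'_def trace_append)
  show thesis
  proof
    show "map snd ls' = map snd ls" using ls1(1) r' by (simp add: ls'_def)
    show "positive_lengths ls'" using ls1(2) r' k assms(3) by (auto simp: ls'_def)
    show "trace p ls \<subseteq> trace p' ls'" using sub1 sub2 by blast
    fix a assume a: "0 \<le> a" "a \<le> M"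
    show "p - a *\<^sub>R clock (snd (hd ls)) \<in> trace p' ls'"
      using bwd[of "- a"] a l sub2 by (auto simp: ls)
    have "p + displacement ls + a *\<^sub>R clock (snd (last ls)) = p' + displacement r' + (k + a) *\<^sub>R clock e"
      using ls1(3) r' by (simp add: e[symmetric] algebra_simps)
    then show "p + displacement ls + a *\<^sub>R clock (snd (last ls)) \<in> trace p' ls'"
      using fwd[of "k + a"] a k by simp
  qed
qed

text \<open>The missing directions are supplied by edges of length 1 before and after; the starting
  point moves back accordingly.\<close>

lemma trace_fill:
  assumes "sublist (map snd ls) full" "positive_lengths ls"
  obtains q fl where "map snd fl = full" "positive_lengths fl" "trace p ls \<subseteq> trace q fl"
proof -
  obtain xs ys where full: "full = xs @ map snd ls @ ys" using assms(1) by (auto simp: sublist_def)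
  define pre post where "pre = map (Pair (1::real)) xs" and "post = map (Pair (1::real)) ys"
  have m: "map snd pre = xs" "map snd post = ys" by (simp_all add: pre_def post_def o_def)
  show thesis
  proof (rule that[of "pre @ ls @ post" "p - displacement pre"])
    show "map snd (pre @ ls @ post) = full" by (simp add: m full)
    show "positive_lengths (pre @ ls @ post)" using assms(2) by (auto simp: pre_def post_def)
    show "trace p ls \<subseteq> trace (p - displacement pre) (pre @ ls @ post)" by (auto simp: trace_append)
  qed
qed

lemma path_image_polygon:
  "path_image (polygonal_path [a, b, c, d, e]) =
    closed_segment a b \<union> closed_segment b c \<union> closed_segment c d \<union> closed_segment d e"
  by (simp add: path_image_join Un_assoc)

lemma polygon_in_simplified:
  assumes "has_directions ps [0, 2, 4, 6]"
  shows "ps \<in> simplified_preferred_paths"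
  unfolding simplified_preferred_paths_def
  by (intro CollectI exI[of _ "[0, 2, 4, 6]"] conjI assms)
    (auto simp: less_Suc_eq nth_Cons' numeral_eq_Suc)

text \<open>The opposites of 6, 8, 10, 0 are 0, 2, 4, 6, so the second pattern is the first one
  traversed backwards.\<close>

lemma trace_polygon:
  assumes "map snd fl = [0, 2, 4, 6] \<or> map snd fl = [0, 10, 8, 6]" "positive_lengths fl"
  obtains a b c d e where "has_directions [a, b, c, d, e] [0, 2, 4, 6]"
    "path_image (polygonal_path [a, b, c, d, e]) = trace p fl"
proof -
  have directions: "has_directions [a, b, c, d, e] [0, 2, 4, 6] \<longleftrightarrow>
      positive_multiple (b - a) (clock 0) \<and> positive_multiple (c - b) (clock 2) \<and>
      positive_multiple (d - c) (clock 4) \<and> positive_multiple (e - d) (clock 6)" for a b c d e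
    by (auto simp: has_directions_def less_Suc_eq)
  from assms(1) show thesis
  proof
    assume "map snd fl = [0, 2, 4, 6]"
    then obtain l1 l2 l3 l4 where fl: "fl = [(l1, 0), (l2, 2), (l3, 4), (l4, 6)]"
      by (auto simp: map_eq_Cons_conv)
    then have pos: "0 < l1" "0 < l2" "0 < l3" "0 < l4" using assms(2) by auto
    define b c d e where "b = p + l1 *\<^sub>R clock 0" and "c = b + l2 *\<^sub>R clock 2"
      and "d = c + l3 *\<^sub>R clock 4" and "e = d + l4 *\<^sub>R clock 6"
    show thesis
    proof
      show "has_directions [p, b, c, d, e] [0, 2, 4, 6]"
        unfolding directions positive_multiple_def
        using pos by (auto simp: b_def c_def d_def e_def)
      show "path_image (polygonal_path [p, b, c, d, e]) = trace p fl"
        unfolding path_image_polygon by (auto simp: fl b_def[symmetric] c_def[symmetric] d_def[symmetric] e_def[symmetric])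
    qed
  next
    assume "map snd fl = [0, 10, 8, 6]"
    then obtain l1 l2 l3 l4 where fl: "fl = [(l1, 0), (l2, 10), (l3, 8), (l4, 6)]"
      by (auto simp: map_eq_Cons_conv)
    then have pos: "0 < l1" "0 < l2" "0 < l3" "0 < l4" using assms(2) by auto
    define b c d e where "b = p + l1 *\<^sub>R clock 0" and "c = b + l2 *\<^sub>R clock 10"
      and "d = c + l3 *\<^sub>R clock 8" and "e = d + l4 *\<^sub>R clock 6"
    have opp: "clock 0 = - clock 6" "clock 2 = - clock 8" "clock 4 = - clock 10" "clock 6 = - clock 0"
      by (simp_all add: clock_values)
    show thesis
    proof
      show "has_directions [e, d, c, b, p] [0, 2, 4, 6]"
        unfolding directions positive_multiple_def
        using pos opp by (auto simp: b_def c_def d_def e_def)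
      show "path_image (polygonal_path [e, d, c, b, p]) = trace p fl"
        unfolding path_image_polygon closed_segment_commute[of e] closed_segment_commute[of d c]
          closed_segment_commute[of c b] closed_segment_commute[of b p]
        by (auto simp: fl b_def[symmetric] c_def[symmetric] d_def[symmetric] e_def[symmetric])
    qed
  qed
qed

lemma reduced_length: "reduced ds \<Longrightarrow> length ds \<le> 4"
  using reduced_sublist[of ds] sublist_length_le[of ds "[0, 2, 4, 6]"] sublist_length_le[of ds "[0, 10, 8, 6]"]
  unfolding list.size by linarith

lemma chain_single: "chain \<gamma> [d] s t \<Longrightarrow> moves \<gamma> d s t"
  by auto

section \<open>Global shape of a geodesic\<close>

context cone_decreasing
begin

lemma geodesic_inj:
  assumes "finsler_geodesic F \<gamma> I"
  shows "inj_on \<gamma> I"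
proof (rule linorder_inj_onI')
  fix s t assume "s \<in> I" "t \<in> I" "s < t"
  then obtain ds where ds: "reduced ds" "chain \<gamma> ds s t" using geodesic_chain[OF assms] by metis
  from chain_trace[OF ds(2)] obtain ls where "map snd ls = ds" "positive_lengths ls" "\<gamma> t = \<gamma> s + displacement ls"
    by blast
  then show "\<gamma> s \<noteq> \<gamma> t" using reduced_displacement_nonzero[of ls] ds(1) by auto
qed

text \<open>A chain with the maximal number of edges already shows all bends. Outside it the
  geodesic continues its first and last edges, and boundedness limits how far these must be
  prolonged.\<close>

lemma geodesic_trace:
  assumes geo: "finsler_geodesic F \<gamma> I" and K: "is_interval K" "K \<subseteq> I" "bounded (\<gamma> ` K)"
  obtains p ls where "reduced (map snd ls)" "positive_lengths ls" "\<gamma> ` K \<subseteq> trace p ls"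
proof (cases "\<exists>s\<in>K. \<exists>t\<in>K. s < t")
  case False
  \<comment> \<open>K has at most one point, and any edge starting at its image will do.\<close>
  then obtain k where "\<gamma> ` K \<subseteq> {k}"
    by (metis image_subsetI linorder_neqE_linordered_idom singletonI)
  then show thesis using start_in_trace[of k "[(1, 0)]"] that[of "[(1, 0)]" k] by (auto simp: reduced_def dirs_def)
next
  case True
  define P where "P = (\<lambda>(ds, s, t). s \<in> K \<and> t \<in> K \<and> reduced ds \<and> chain \<gamma> ds s t)"
  obtain s0 t0 where st0: "s0 \<in> K" "t0 \<in> K" "s0 < t0" using True by blast
  then obtain ds0 where "reduced ds0" "chain \<gamma> ds0 s0 t0" using geodesic_chain[OF geo] K(2) by blast
  then have P0: "P (ds0, s0, t0)" using st0 by (simp add: P_def)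
  have "length (fst y) \<le> 4" if "P y" for y
    using that reduced_length by (cases y) (simp add: P_def)
  \<comment> \<open>The maximum exists because a reduced chain has at most four edges.\<close>
  then have "\<exists>z. P z \<and> (\<forall>y. P y \<longrightarrow> length (fst y) \<le> length (fst z))"
    using P0 by (intro Lattices_Big.ex_has_greatest_nat[where P = P and b = 5]) (auto simp: less_Suc_eq_le numeral_eq_Suc)
  then obtain z where z: "P z" "\<And>y. P y \<Longrightarrow> length (fst y) \<le> length (fst z)"
    by metis
  obtain ds s t where "z = (ds, s, t)" by (metis surj_pair)
  then have ds: "s \<in> K" "t \<in> K" "reduced ds" "chain \<gamma> ds s t"
    and max: "\<And>es x y. \<lbrakk>x \<in> K; y \<in> K; reduced es; chain \<gamma> es x y\<rbrakk> \<Longrightarrow> length es \<le> length ds"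
    using z by (auto simp: P_def)
  have ne: "ds \<noteq> []" using ds(3) by (simp add: reduced_def)
  have st: "s < t" using ds(4) ne by (cases ds) auto
  \<comment> \<open>Appending the chain from t to x creates no further edge, so it is one edge that
    merges with the last one.\<close>
  have later: "moves \<gamma> (last ds) t x" if x: "x \<in> K" "t < x" for x
  proof -
    obtain es where es: "reduced es" "chain \<gamma> es t x" using geodesic_chain[OF geo] x ds(2) K(2) by blast
    then obtain e es' where e: "es = e # es'" by (cases es) (auto simp: reduced_def)
    from geodesic_chain_join[OF geo _ _ ds(3,4) es] have "last ds = e \<and> es' = []"
      using max[of s x "ds @ es'"] max[of s x "ds @ es"] ds x K(2) by (auto simp: e)
    then show ?thesis using es(2) e chain_single by blast
  qed
  have earlier: "moves \<gamma> (hd ds) x s" if x: "x \<in> K" "x < s" for x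
  proof -
    obtain es where es: "reduced es" "chain \<gamma> es x s" using geodesic_chain[OF geo] x ds(1) K(2) by blast
    then have nes: "es \<noteq> []" by (auto simp: reduced_def)
    from geodesic_chain_join[OF geo _ _ es ds(3,4)] have "last es = hd ds \<and> length es \<le> 1"
      using max[of x t "es @ tl ds"] max[of x t "es @ ds"] ds x K(2) ne nes by (cases ds) auto
    then have "es = [hd ds]" using nes by (cases es) auto
    then show ?thesis using es(2) chain_single by blast
  qed
  from chain_trace[OF ds(4)] obtain ls where ls: "map snd ls = ds" "positive_lengths ls"
      "\<gamma> ` {s..t} \<subseteq> trace (\<gamma> s) ls" "\<gamma> t = \<gamma> s + displacement ls" by blast
  have lne: "ls \<noteq> []" using ls(1) ne by auto
  obtain C where C: "0 < C" "\<And>x. x \<in> K \<Longrightarrow> norm (\<gamma> x) \<le> C"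
    using K(3) by (auto simp: bounded_pos)
  obtain p' ls' where ls': "map snd ls' = ds" "positive_lengths ls'" "trace (\<gamma> s) ls \<subseteq> trace p' ls'"
    and bwd: "\<And>a. 0 \<le> a \<Longrightarrow> a \<le> 2 * C \<Longrightarrow> \<gamma> s - a *\<^sub>R clock (hd ds) \<in> trace p' ls'"
    and fwd: "\<And>a. 0 \<le> a \<Longrightarrow> a \<le> 2 * C \<Longrightarrow> \<gamma> t + a *\<^sub>R clock (last ds) \<in> trace p' ls'"
  proof (rule trace_extend[OF lne ls(2), of "2 * C" "\<gamma> s"])
    fix p' ls' assume H: "map snd ls' = map snd ls" "positive_lengths ls'" "trace (\<gamma> s) ls \<subseteq> trace p' ls'"
      "\<And>a. 0 \<le> a \<Longrightarrow> a \<le> 2 * C \<Longrightarrow> \<gamma> s - a *\<^sub>R clock (snd (hd ls)) \<in> trace p' ls'"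
      "\<And>a. 0 \<le> a \<Longrightarrow> a \<le> 2 * C \<Longrightarrow> \<gamma> s + displacement ls + a *\<^sub>R clock (snd (last ls)) \<in> trace p' ls'"
    have "hd ds = snd (hd ls)" "last ds = snd (last ls)"
      unfolding ls(1)[symmetric] using lne by (simp_all add: hd_map last_map)
    then show thesis using that[of ls' p'] H ls(1,4) by simp
  qed (use C(1) in simp)
  have dirs: "hd ds \<in> dirs" "last ds \<in> dirs" using ds(3) ne by (auto simp: reduced_def)
  \<comment> \<open>An edge between two points of a set in the ball of radius C has length at most 2
    * C.\<close>
  have small: "r \<le> 2 * C" if "x \<in> K" "y \<in> K" "\<gamma> y - \<gamma> x = r *\<^sub>R clock d" "d \<in> dirs" "0 < r" for x y r d
  proof -
    have "r = norm (\<gamma> y - \<gamma> x)" using that dirs_norm by simp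
    also have "\<dots> \<le> 2 * C" using norm_triangle_ineq4[of "\<gamma> y" "\<gamma> x"] C(2)[OF that(1)] C(2)[OF that(2)] by linarith
    finally show ?thesis .
  qed
  show thesis
  proof (rule that[of ls' p'])
    show "reduced (map snd ls')" using ls' ds by simp
    show "positive_lengths ls'" by fact
    show "\<gamma> ` K \<subseteq> trace p' ls'"
    proof (rule image_subsetI)
      fix x assume x: "x \<in> K"
      consider "x < s" | "x \<in> {s..t}" | "t < x" by force
      then show "\<gamma> x \<in> trace p' ls'"
      proof cases
        case 1
        then obtain r where r: "0 < r" "\<gamma> s - \<gamma> x = r *\<^sub>R clock (hd ds)"
          using earlier[OF x 1] unfolding moves_def positive_multiple_def by blast
        then have "\<gamma> x = \<gamma> s - r *\<^sub>R clock (hd ds)" by (simp add: algebra_simps)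
        then show ?thesis using bwd[of r] r small[OF x ds(1) r(2) dirs(1)] by simp
      next
        case 2 then show ?thesis using ls(3) ls'(3) by blast
      next
        case 3
        then obtain r where r: "0 < r" "\<gamma> x - \<gamma> t = r *\<^sub>R clock (last ds)"
          using later[OF x 3] unfolding moves_def positive_multiple_def by blast
        then have "\<gamma> x = \<gamma> t + r *\<^sub>R clock (last ds)" by (simp add: algebra_simps)
        then show ?thesis using fwd[of r] r small[OF ds(2) x r(2) dirs(2)] by simp
      qed
    qed
  qed
qed

lemma geodesic_in_polygon:
  assumes "finsler_geodesic F \<gamma> I" "is_interval K" "K \<subseteq> I" "bounded (\<gamma> ` K)"
  obtains a b c d e where "has_directions [a, b, c, d, e] [0, 2, 4, 6]"
    "\<gamma> ` K \<subseteq> path_image (polygonal_path [a, b, c, d, e])"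
proof -
  obtain p ls where ls: "reduced (map snd ls)" "positive_lengths ls" "\<gamma> ` K \<subseteq> trace p ls"
    by (rule geodesic_trace[OF assms])
  obtain q fl where fl: "map snd fl = [0, 2, 4, 6] \<or> map snd fl = [0, 10, 8, 6]" "positive_lengths fl"
      "trace p ls \<subseteq> trace q fl"
    using reduced_sublist[OF ls(1)] trace_fill[OF _ ls(2)] by metis
  obtain a b c d e where "has_directions [a, b, c, d, e] [0, 2, 4, 6]"
    "path_image (polygonal_path [a, b, c, d, e]) = trace q fl"
    by (rule trace_polygon[OF fl(1,2)])
  then show thesis using that ls(3) fl(3) by blast
qed

end

theorem theorem7p8:
  fixes \<theta> L :: real and a0 b0 c0 d0 :: plane and f :: "plane \<Rightarrow> real"
    and \<gamma> :: "real \<Rightarrow> plane" and I :: "real set"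
  assumes "pi / 3 < \<theta>" and "\<theta> \<le> pi / 2"
    and "trapezoid \<theta> a0 b0 c0 d0"
    and "L = euclidean_length [d0, a0, b0, c0] / euclidean_length [c0, d0]"
    and "continuous_on UNIV f"
    and "\<And>x. 0 < f x"
    and "\<And>p q. q \<in> cone_at \<theta> p \<Longrightarrow> f q < f p"
    and "\<And>x. f x \<in> {1<..<L}"
    and "finsler_geodesic (\<lambda>x y. f x * F0 y) \<gamma> I"
  shows "inj_on \<gamma> I \<and>
    (\<forall>K. is_interval K \<and> K \<subseteq> I \<and> bounded (\<gamma> ` K) \<longrightarrow>
      (\<exists>a b c d e. [a, b, c, d, e] \<in> simplified_preferred_paths \<and>
         has_directions [a, b, c, d, e] [0, 2, 4, 6] \<and>
         subpath_of \<gamma> K (polygonal_path [a, b, c, d, e])))"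
proof -
  \<comment> \<open>The angle condition supplies the thin cones with which f satisfies the
    assumptions of the locale.\<close>
  obtain \<eta> where eta: "0 < \<eta>" "\<And>d z r \<beta>. \<lbrakk>d \<in> updirs; 0 < r; \<bar>\<beta>\<bar> \<le> \<eta> * r\<rbrakk> \<Longrightarrow>
      z + r *\<^sub>R clock d + \<beta> *\<^sub>R perp (clock d) \<in> cone_at \<theta> z"
    using cone_contains[OF assms(1,2)] by metis
  interpret cone_decreasing f \<eta>
    by unfold_locales (use assms(5-7) eta in auto)
  have inj: "inj_on \<gamma> I" using assms(9) by (rule geodesic_inj)
  moreover have "\<exists>a b c d e. [a, b, c, d, e] \<in> simplified_preferred_paths \<and>
      has_directions [a, b, c, d, e] [0, 2, 4, 6] \<and> subpath_of \<gamma> K (polygonal_path [a, b, c, d, e])"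
    if K: "is_interval K" "K \<subseteq> I" "bounded (\<gamma> ` K)" for K
  proof -
    obtain a b c d e where p: "has_directions [a, b, c, d, e] [0, 2, 4, 6]"
        "\<gamma> ` K \<subseteq> path_image (polygonal_path [a, b, c, d, e])"
      by (rule geodesic_in_polygon[OF assms(9) K])
    moreover have "inj_on \<gamma> K" using inj K(2) by (rule inj_on_subset)
    ultimately show ?thesis using polygon_in_simplified[OF p(1)] unfolding subpath_of_def by blast
  qed
  ultimately show ?thesis by blast
qed

end
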